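(* Let $\mathcal{S}$ be a finite left regular band of abelian groups with an action of a finite group $W$ satisfying $w\cdot(st)=(w\cdot s)(w\cdot t)$, and let $\{\mathfrak{u}_X\}_{X\in E(\mathcal{T})}$ be a $W$-invariant homogeneous section. For each $W$-orbit $\lambda\in\widehat{\mathcal{T}}^W$ set $$\mathfrak{e}_\lambda:=\sum_{\Phi\in\lambda}\mathfrak{e}_\Phi.$$ Then $\{\mathfrak{e}_\lambda\}_{\lambda\in\widehat{\mathcal{T}}^W}$ is a complete system of primitive orthogonal idempotents of the invariant subalgebra $(\mathbb{C}\mathcal{S})^W$.
   Context: All semigroups finite; $s^\omega$ is the idempotent positive power of $s$. A left regular band of groups (LRBG) is a finite semigroup with $s^\omega s=s$, $sts^\omega=st$; $E(\mathcal{S})$ its idempotents; $G_x=\{s:s^\omega=x\}$ (a group); "of abelian groups" means all $G_x$ abelian. $s\sim t$ iff $s^\omega t=s$ and $t^\omega s=t$; $\mathcal{T}=\mathcal{S}/\!\sim$ with quotient map $\mathsf{supp}$; $E(\mathcal{T})=\mathsf{supp}(E(\mathcal{S}))$ ordered by $X\le Y$ iff $XY=Y$. $\mathbb{C}\mathcal{S}$ has basis $\mathbf{H}_s$, $\mathbf{H}_s\mathbf{H}_t=\mathbf{H}_{st}$. Homogeneous section: $\mathfrak{u}_X=\sum_{x\in E(\mathcal{S}),\mathsf{supp}(x)=X}c_x\mathbf{H}_x$ with $\sum c_x=1$; $\mathfrak{e}^\circ_X=\mathfrak{u}_X-\sum_{Y>X}\mathfrak{u}_X\mathfrak{e}^\circ_Y$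 recursively; $\mathbf{Q}^\circ_x=\mathbf{H}_x\mathfrak{e}^\circ_{\mathsf{supp}(x)}$. $\lambda_{y,x}:G_x\to G_{yx}$, $s\mapsto ys$. $\widehat{\mathcal{S}}=\bigsqcup_x\mathrm{Hom}(G_x,\mathbb{C}^\times)$, $|\phi|=x$ for $\phi\in\widehat{G_x}$; $\phi\sim\psi$ iff $|\phi|\sim|\psi|$ and $\phi=\psi\circ\lambda_{|\psi|,|\phi|}$; $\widehat{\mathcal{T}}=\widehat{\mathcal{S}}/\!\sim$ with class map $\mathsf{supp}$. $\mathbf{E}_\phi=\frac1{|G_{|\phi|}|}\sum_{s\in G_{|\phi|}}\overline{\phi(s)}\mathbf{H}_s$, $\mathbf{Q}_\phi=\mathbf{E}_\phi\mathbf{Q}^\circ_{|\phi|}$, and $\mathfrak{e}_\Phi=\mathfrak{u}_{\mathsf{supp}(|\phi|)}\mathbf{Q}_\phi$ for any $\phi$ with $\mathsf{supp}(\phi)=\Phi$ (independent of choice). The $W$-action induces actions on $E(\mathcal{S})$, $\mathcal{T}$, $E(\mathcal{T})$ (via $w\cdot\mathsf{supp}(s)=\mathsf{supp}(w\cdot s)$), group isomorphisms $G_x\to G_{w\cdot x}$, an action on $\widehat{\mathcal{S}}$ by $(w\cdot\phi)(s)=\phi(w^{-1}\cdot s)$ for $s\in G_{w\cdot|\phi|}$, and hence an action on $\widehat{\mathcal{T}}$; $\widehat{\mathcal{T}}^W$ denotes the set of $W$-orbits. $W$ acts on $\mathbb{C}\mathcal{S}$ by $w\cdot\mathbf{H}_s=\mathbf{H}_{w\cdot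 s}$ and $(\mathbb{C}\mathcal{S})^W$ is the subalgebra of invariants. The section is $W$-invariant if $w\cdot\mathfrak{u}_X=\mathfrak{u}_{w\cdot X}$ for all $w,X$. *)

theory Defs
  imports Complex_Main "HOL-Algebra.Group_Action"
begin

section \<open>Left regular bands of groups\<close>

text \<open>Semigroups have no unit, so positive powers are indexed from zero:
  \<open>spow s n\<close> is the power of \<open>s\<close> with exponent \<open>n + 1\<close>.\<close>

primrec (in semigroup_mult) spow :: "'a \<Rightarrow> nat \<Rightarrow> 'a" where
  "spow s 0 = s"
| "spow s (Suc n) = s * spow s n"

definition (in semigroup_mult) omega :: "'a \<Rightarrow> 'a" where
  "omega s = (THE e. e * e = e \<and> (\<exists>n. e = spow s n))"

class lrbg = semigroup_mult + finite +
  assumes omega_absorb: "omega s * s = s"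
    and omega_regular: "s * t * omega s = s * t"

definition idems :: "'s::semigroup_mult set" where
  "idems = {x. x * x = x}"

definition maxgroup :: "'s::semigroup_mult \<Rightarrow> 's monoid" where
  "maxgroup x = \<lparr>carrier = {s. omega s = x}, mult = (*), one = x\<rparr>"

definition simS :: "('s::semigroup_mult \<times> 's) set" where
  "simS = {(s, t). omega s * t = s \<and> omega t * s = t}"

text \<open>Elements of \<open>T\<close> are equivalence classes, that is, subsets of \<open>S\<close>.\<close>

definition supp :: "'s::semigroup_mult \<Rightarrow> 's set" where
  "supp s = simS `` {s}"

text \<open>The product of \<open>T\<close>: the common class of all products of representatives
  (see \<open>mult_T_supp\<close> below).\<close>

definition mult_T :: "'s::semigroup_mult set \<Rightarrow> 's set \<Rightarrow> 's set" where
  "mult_T X Y = the_elem ((\<lambda>(s, t). supp (s * t)) ` (X \<times> Y))"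

definition idems_T :: "'s::semigroup_mult set set" where
  "idems_T = supp ` idems"

definition less_eq_T :: "'s::semigroup_mult set \<Rightarrow> 's set \<Rightarrow> bool" where
  "less_eq_T X Y \<longleftrightarrow> X \<in> idems_T \<and> Y \<in> idems_T \<and> mult_T X Y = Y"

definition less_T :: "'s::semigroup_mult set \<Rightarrow> 's set \<Rightarrow> bool" where
  "less_T X Y \<longleftrightarrow> less_eq_T X Y \<and> X \<noteq> Y"

subsection \<open>Well-definedness\<close>

lemma spow_add: "spow s m * spow s n = spow s (m + n + 1)"
  for s :: "'s::semigroup_mult"
  by (induction m) (simp_all add: mult.assoc)

lemma spow_Suc_right: "spow s (Suc n) = spow s n * s"
  for s :: "'s::semigroup_mult"
  using spow_add[of s n 0] by simp

lemma spow_spow: "spow (spow s m) n = spow s (m * n + m + n)"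
  for s :: "'s::semigroup_mult"
  by (induction n) (simp_all add: spow_add algebra_simps)

lemma spow_idem: "e * e = e \<Longrightarrow> spow e n = e"
  for e :: "'s::semigroup_mult"
  by (induction n) simp_all

lemma idem_spow_unique:
  fixes s :: "'s::semigroup_mult"
  assumes "spow s m * spow s m = spow s m" "spow s n * spow s n = spow s n"
  shows "spow s m = spow s n"
proof -
  have "spow s m = spow (spow s m) n" using spow_idem[OF assms(1)] by simp
  also have "\<dots> = spow (spow s n) m" by (simp add: spow_spow algebra_simps)
  also have "\<dots> = spow s n" using spow_idem[OF assms(2)] by simp
  finally show ?thesis .
qed

lemma idem_spow_exists:
  fixes s :: "'s::{semigroup_mult, finite}"
  shows "\<exists>n. spow s n * spow s n = spow s n"
proof -
  have "\<not> inj (spow s)"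
    using finite_imageD[of "spow s" UNIV] by (metis finite infinite_UNIV_nat)
  then obtain i j where "i \<noteq> j" "spow s i = spow s j"
    by (auto simp: inj_def)
  then obtain a p where p: "p > 0" and eq: "spow s a = spow s (a + p)"
    by (metis less_imp_add_positive linorder_neqE_nat)
  have shift: "spow s (a + b) = spow s (a + b + p)" for b
  proof (cases b)
    case 0 then show ?thesis using eq by simp
  next
    case (Suc c)
    then show ?thesis using eq spow_add[of s a c] spow_add[of s "a + p" c]
      by (simp add: algebra_simps)
  qed
  have shifts: "spow s (a + b) = spow s (a + b + k * p)" for b k
  proof (induction k)
    case 0 then show ?case by simp
  next
    case (Suc k)
    then show ?case using shift[of "b + k * p"] by (simp add: algebra_simps)
  qed
  define N where "N = (a + 1) * p - 1"
  have N1: "N + 1 = (a + 1) * p" using p by (simp add: N_def)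
  have "(a + 1) * 1 \<le> (a + 1) * p" using p by (intro mult_le_mono2) simp
  then have "a \<le> N" using N1 by simp
  then have "spow s N = spow s (N + (a + 1) * p)"
    using shifts[of "N - a" "a + 1"] by simp
  also have "\<dots> = spow s N * spow s N" by (simp only: spow_add N1[symmetric]) simp
  finally show ?thesis by metis
qed

lemma omega_eqI: "e * e = e \<Longrightarrow> e = spow s n \<Longrightarrow> omega s = e"
  for s :: "'s::semigroup_mult"
  unfolding omega_def by (rule the_equality) (use idem_spow_unique in blast)+

lemma omega_spow:
  fixes s :: "'s::{semigroup_mult, finite}"
  obtains n where "omega s = spow s n" "omega s * omega s = omega s"
  using idem_spow_exists[of s] omega_eqI by metis

lemma omega_idem: "e * e = e \<Longrightarrow> omega e = e"
  for e :: "'s::semigroup_mult"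
  using omega_eqI[of e e 0] by simp

lemma spow_commute: "spow s n * s = s * spow s n"
  for s :: "'s::semigroup_mult"
  using spow_Suc_right[of s n] by simp

lemma mult_omega: "s * omega s = s" for s :: "'s::lrbg"
  by (metis omega_absorb omega_spow spow_commute)

lemma simS_iff: "(s, t) \<in> simS \<longleftrightarrow> omega s * t = s \<and> omega t * s = t"
  by (simp add: simS_def)

lemma simS_mult_omega:
  fixes s t :: "'s::lrbg"
  assumes "(s, t) \<in> simS" shows "omega s * omega t = omega s"
proof -
  have "s * omega t = s"
    using assms by (metis mult.assoc mult_omega simS_iff)
  then have "spow s n * omega t = spow s n" for n
    by (induction n) (simp_all add: mult.assoc)
  then show ?thesis by (metis omega_spow)
qed

lemma equiv_simS: "equiv UNIV (simS :: ('s::lrbg \<times> 's) set)"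
proof (rule equivI)
  show "refl (simS :: ('s \<times> 's) set)" by (auto simp: refl_on_def simS_iff omega_absorb)
  show "sym (simS :: ('s \<times> 's) set)" by (auto simp: sym_def simS_iff)
  have half: "omega s * u = s" if "(s, t) \<in> simS" "(t, u) \<in> simS" for s t u :: 's
    using that simS_mult_omega[OF that(1)] by (metis mult.assoc simS_iff)
  have symm: "(t, s) \<in> simS" if "(s, t) \<in> simS" for s t :: 's
    using that by (simp add: simS_iff)
  show "trans (simS :: ('s \<times> 's) set)"
    unfolding trans_def by (meson half symm simS_iff)
qed simp

lemma simS_mult_half:
  fixes s t s' t' :: "'s::lrbg"
  assumes "(s, s') \<in> simS" "(t, t') \<in> simS"
  shows "omega (s * t) * (s' * t') = s * t"
proof -
  obtain n where n: "omega (s * t) = spow (s * t) n" by (rule omega_spow)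
  obtain p where p: "omega (s * t) = s * t \<or> omega (s * t) = p * (s * t)"
    using n spow_Suc_right by (cases n) auto
  have regular: "a * b * a' = a * b * a" if "(a, a') \<in> simS" for a b a' :: 's
  proof -
    have "a * b * a' = a * b * (omega a * a')"
      using omega_regular[of a b] by (simp add: mult.assoc[symmetric])
    also have "\<dots> = a * b * a" using that by (simp add: simS_iff)
    finally show ?thesis .
  qed
  have 1: "s * t * s' = s * t * s" and 2: "t * s * t' = t * s * t"
    using regular assms by blast+
  have "omega (s * t) * s' = omega (s * t) * s"
    using p 1 by (auto simp: mult.assoc)
  moreover have "omega (s * t) * s * t' = omega (s * t) * s * t"
    using p 2 by (auto simp: mult.assoc)
  ultimately have "omega (s * t) * (s' * t') = omega (s * t) * (s * t)"
    by (simp add: mult.assoc[symmetric])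
  then show ?thesis by (simp add: omega_absorb)
qed

lemma supp_eq_iff: "supp s = supp t \<longleftrightarrow> (s, t) \<in> simS" for s t :: "'s::lrbg"
  unfolding supp_def using eq_equiv_class_iff[OF equiv_simS] by blast

lemma mult_T_supp: "mult_T (supp s) (supp t) = supp (s * t)" for s t :: "'s::lrbg"
proof -
  have "supp (s' * t') = supp (s * t)" if "s' \<in> supp s" "t' \<in> supp t" for s' t'
  proof -
    have "(s, s') \<in> simS" "(t, t') \<in> simS" "(s', s) \<in> simS" "(t', t) \<in> simS"
      using that by (auto simp: supp_def simS_iff)
    then show ?thesis by (simp add: supp_eq_iff simS_iff simS_mult_half)
  qed
  moreover have "s \<in> supp s" "t \<in> supp t"
    by (auto simp: supp_def simS_iff omega_absorb)
  ultimately have "(\<lambda>(s, t). supp (s * t)) ` (supp s \<times> supp t) = {supp (s * t)}"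
    by fast
  then show ?thesis by (simp add: mult_T_def)
qed

lemma less_eq_T_supp:
  fixes x y :: "'s::lrbg"
  assumes "x \<in> idems" "y \<in> idems"
  shows "less_eq_T (supp x) (supp y) \<longleftrightarrow> y * x = y"
proof -
  have xy: "x * x = x" "y * y = y" using assms by (simp_all add: idems_def)
  have oy: "omega y = y" using xy omega_idem by blast
  have "x * y * (x * y) = x * y"
    by (metis mult.assoc omega_idem omega_regular xy)
  then have oxy: "omega (x * y) = x * y" by (rule omega_idem)
  have "y * (x * y) = y * x" by (metis mult.assoc omega_regular oy)
  then show ?thesis
    using assms oy oxy xy
    by (auto simp: less_eq_T_def idems_T_def mult_T_supp supp_eq_iff simS_iff mult.assoc)
qed

lemma less_T_trans:
  fixes X Y Z :: "'s::lrbg set"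
  assumes "less_T X Y" "less_T Y Z" shows "less_T X Z"
proof -
  obtain x y z where e: "x \<in> idems" "y \<in> idems" "z \<in> idems"
    and X: "X = supp x" "Y = supp y" "Z = supp z"
    using assms unfolding less_T_def less_eq_T_def idems_T_def by blast
  have yx: "y * x = y" and zy: "z * y = z"
    using assms e X by (auto simp: less_T_def less_eq_T_supp)
  have "z * x = z" using yx zy by (metis mult.assoc)
  moreover have "X \<noteq> Z"
  proof
    assume "X = Z"
    then have "x * y = x" using assms e X less_eq_T_supp by (metis less_T_def)
    then have "X = Y" using yx e X
      by (simp add: supp_eq_iff simS_iff idems_def omega_idem)
    then show False using assms by (simp add: less_T_def)
  qed
  ultimately show ?thesis using e X by (simp add: less_T_def less_eq_T_supp)
qed

section \<open>The semigroup algebra\<close>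

text \<open>Coefficient functions wrapped in a type, so that the convolution product makes it an
  instance of the (not necessarily unital) class \<open>ring\<close>.\<close>

typedef 's semigroup_algebra = "UNIV :: ('s \<Rightarrow> complex) set"
  morphisms coeff Abs_semigroup_algebra ..

lemma semigroup_algebra_eqI: "(\<And>s. coeff a s = coeff b s) \<Longrightarrow> a = b"
  by (metis coeff_inject ext)

instantiation semigroup_algebra :: ("{semigroup_mult, finite}") ring
begin

definition "0 = Abs_semigroup_algebra (\<lambda>_. 0)"
definition "a + b = Abs_semigroup_algebra (\<lambda>s. coeff a s + coeff b s)"
definition "- a = Abs_semigroup_algebra (\<lambda>s. - coeff a s)"
definition "a - b = Abs_semigroup_algebra (\<lambda>s. coeff a s - coeff b s)"
definition "a * b = Abs_semigroup_algebra
  (\<lambda>r. \<Sum>(s, t) \<in> {(s, t). s * t = r}. coeff a s * coeff b t)"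

lemma coeff_zero: "coeff 0 s = 0"
  and coeff_add: "coeff (a + b) s = coeff a s + coeff b s"
  and coeff_uminus: "coeff (- a) s = - coeff a s"
  and coeff_diff: "coeff (a - b) s = coeff a s - coeff b s"
  by (simp_all add: zero_semigroup_algebra_def plus_semigroup_algebra_def
      uminus_semigroup_algebra_def minus_semigroup_algebra_def Abs_semigroup_algebra_inverse)

lemma coeff_mult:
  "coeff (a * b) r = (\<Sum>s\<in>UNIV. \<Sum>t\<in>UNIV. if s * t = r then coeff a s * coeff b t else 0)"
proof -
  have "coeff (a * b) r = (\<Sum>(s, t) \<in> {(s, t). s * t = r}. coeff a s * coeff b t)"
    by (simp add: times_semigroup_algebra_def Abs_semigroup_algebra_inverse)
  also have "\<dots> = (\<Sum>p\<in>UNIV \<times> UNIV.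
      if fst p * snd p = r then coeff a (fst p) * coeff b (snd p) else 0)"
    by (rule sum.mono_neutral_cong_left) (auto split: if_splits)
  finally show ?thesis by (simp add: sum.cartesian_product case_prod_beta)
qed

instance
proof
  fix a b c :: "'a semigroup_algebra"
  have sw: "(\<Sum>r\<in>UNIV. if p = r then f r else 0) = f p" for p :: 'a and f :: "'a \<Rightarrow> complex"
    by (simp add: sum.delta)
  have L: "coeff (a * b * c) r = (\<Sum>s\<in>UNIV. \<Sum>t\<in>UNIV. \<Sum>u\<in>UNIV.
      if s * t * u = r then coeff a s * coeff b t * coeff c u else 0)" for r
  proof -
    have "coeff (a * b * c) r = (\<Sum>q\<in>UNIV. \<Sum>u\<in>UNIV. \<Sum>s\<in>UNIV. \<Sum>t\<in>UNIV.
        if s * t = q then (if q * u = r then coeff a s * coeff b t * coeff c u else 0) else 0)"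
      unfolding coeff_mult
      by (intro sum.cong refl)
        (simp add: sum_distrib_right if_distrib[of "\<lambda>z. z * _"] cong: if_cong)
    also have "\<dots> = (\<Sum>s\<in>UNIV. \<Sum>t\<in>UNIV. \<Sum>u\<in>UNIV. \<Sum>q\<in>UNIV.
        if s * t = q then (if q * u = r then coeff a s * coeff b t * coeff c u else 0) else 0)"
      (is "?A = ?B")
    proof -
      define F where "F q u s t =
        (if s * t = q then (if q * u = r then coeff a s * coeff b t * coeff c u else 0) else 0)"
        for q u s t
      have "(\<Sum>q\<in>UNIV. \<Sum>u\<in>UNIV. \<Sum>s\<in>UNIV. \<Sum>t\<in>UNIV. F q u s t)
          = (\<Sum>q\<in>UNIV. \<Sum>s\<in>UNIV. \<Sum>u\<in>UNIV. \<Sum>t\<in>UNIV. F q u s t)"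
        by (intro sum.cong refl sum.swap)
      also have "\<dots> = (\<Sum>s\<in>UNIV. \<Sum>q\<in>UNIV. \<Sum>u\<in>UNIV. \<Sum>t\<in>UNIV. F q u s t)"
        by (rule sum.swap)
      also have "\<dots> = (\<Sum>s\<in>UNIV. \<Sum>q\<in>UNIV. \<Sum>t\<in>UNIV. \<Sum>u\<in>UNIV. F q u s t)"
        by (intro sum.cong refl sum.swap)
      also have "\<dots> = (\<Sum>s\<in>UNIV. \<Sum>t\<in>UNIV. \<Sum>q\<in>UNIV. \<Sum>u\<in>UNIV. F q u s t)"
        by (intro sum.cong refl sum.swap)
      also have "\<dots> = (\<Sum>s\<in>UNIV. \<Sum>t\<in>UNIV. \<Sum>u\<in>UNIV. \<Sum>q\<in>UNIV. F q u s t)"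
        by (intro sum.cong refl sum.swap)
      finally show ?thesis unfolding F_def .
    qed
    finally show ?thesis by (simp add: sw)
  qed
  have R: "coeff (a * (b * c)) r = (\<Sum>s\<in>UNIV. \<Sum>t\<in>UNIV. \<Sum>u\<in>UNIV.
      if s * t * u = r then coeff a s * coeff b t * coeff c u else 0)" for r
  proof -
    have "coeff (a * (b * c)) r = (\<Sum>s\<in>UNIV. \<Sum>q\<in>UNIV. \<Sum>t\<in>UNIV. \<Sum>u\<in>UNIV.
        if t * u = q then (if s * q = r then coeff a s * coeff b t * coeff c u else 0) else 0)"
      unfolding coeff_mult
      by (intro sum.cong refl) (simp add: sum_distrib_left mult.assoc if_distrib[of "\<lambda>z. _ * z"] cong: if_cong)
    also have "\<dots> = (\<Sum>s\<in>UNIV. \<Sum>t\<in>UNIV. \<Sum>q\<in>UNIV. \<Sum>u\<in>UNIV.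
        if t * u = q then (if s * q = r then coeff a s * coeff b t * coeff c u else 0) else 0)"
      by (intro sum.cong refl sum.swap)
    also have "\<dots> = (\<Sum>s\<in>UNIV. \<Sum>t\<in>UNIV. \<Sum>u\<in>UNIV. \<Sum>q\<in>UNIV.
        if t * u = q then (if s * q = r then coeff a s * coeff b t * coeff c u else 0) else 0)"
      by (intro sum.cong refl sum.swap)
    finally show ?thesis by (simp add: sw mult.assoc)
  qed
  show "a * b * c = a * (b * c)"
    by (rule semigroup_algebra_eqI) (simp only: L R)
  show "(a + b) * c = a * c + b * c"
    by (rule semigroup_algebra_eqI, unfold coeff_add coeff_mult, unfold sum.distrib[symmetric])
      (intro sum.cong refl, simp add: algebra_simps)
  show "a * (b + c) = a * b + a * c"
    by (rule semigroup_algebra_eqI, unfold coeff_add coeff_mult, unfold sum.distrib[symmetric])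
      (intro sum.cong refl, simp add: algebra_simps)
qed (rule semigroup_algebra_eqI,
    simp add: coeff_zero coeff_add coeff_uminus coeff_diff algebra_simps)+

end

definition scale :: "complex \<Rightarrow> 's semigroup_algebra \<Rightarrow> 's semigroup_algebra" where
  "scale c a = Abs_semigroup_algebra (\<lambda>s. c * coeff a s)"

definition H :: "'s \<Rightarrow> 's semigroup_algebra" where
  "H s = Abs_semigroup_algebra (\<lambda>t. if t = s then 1 else 0)"

lemma H_mult: "H s * H t = H (s * t)" for s t :: "'s::{semigroup_mult, finite}"
proof (rule semigroup_algebra_eqI)
  fix r
  have H: "coeff (H x) y = (if y = x then 1 else 0)" for x y :: 's
    by (simp add: H_def Abs_semigroup_algebra_inverse)
  have "coeff (H s * H t) r = (\<Sum>s'\<in>UNIV. \<Sum>t'\<in>UNIV.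
      if t' = t then (if s' = s then (if s * t = r then 1 else 0) else 0) else 0)"
    unfolding coeff_mult by (intro sum.cong refl) (simp add: H)
  also have "\<dots> = coeff (H (s * t)) r"
    by (auto simp: H)
  finally show "coeff (H s * H t) r = coeff (H (s * t)) r" .
qed

text \<open>Linear extension of a map of the basis.\<close>

definition lin_ext :: "('s \<Rightarrow> 's) \<Rightarrow> 's semigroup_algebra \<Rightarrow> 's::{semigroup_mult, finite} semigroup_algebra"
  where "lin_ext f a = (\<Sum>s\<in>UNIV. scale (coeff a s) (H (f s)))"

section \<open>Homogeneous sections and the associated elements\<close>

definition homogeneous_section ::
    "('s::{semigroup_mult, finite} set \<Rightarrow> 's semigroup_algebra) \<Rightarrow> bool" where
  "homogeneous_section u \<longleftrightarrow>
    (\<forall>X\<in>idems_T. \<exists>c. u X = (\<Sum>x | x \<in> idems \<and> supp x = X. scale (c x) (H x))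
      \<and> (\<Sum>x | x \<in> idems \<and> supp x = X. c x) = 1)"

function e_circ ::
    "('s::lrbg set \<Rightarrow> 's semigroup_algebra) \<Rightarrow> 's set \<Rightarrow> 's semigroup_algebra" where
  "e_circ u X = u X - (\<Sum>Y | less_T X Y. u X * e_circ u Y)"
  by auto
termination
proof (relation "measure (\<lambda>(u, X). card {Y. less_T X Y})")
  fix u :: "'s::lrbg set \<Rightarrow> 's semigroup_algebra" and X Y :: "'s set"
  assume "Y \<in> Collect (less_T X)"
  then have "{Z. less_T Y Z} \<subset> {Z. less_T X Z}"
    using less_T_trans by (auto simp: less_T_def)
  then show "((u, Y), (u, X)) \<in> measure (\<lambda>(u, X). card {Y. less_T X Y})"
    by (simp add: psubset_card_mono)
qed simp

declare e_circ.simps [simp del]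

definition Q_circ :: "('s::lrbg set \<Rightarrow> 's semigroup_algebra) \<Rightarrow> 's \<Rightarrow> 's semigroup_algebra" where
  "Q_circ u x = H x * e_circ u (supp x)"

section \<open>Characters\<close>

definition cunits :: "complex monoid" where
  "cunits = \<lparr>carrier = UNIV - {0}, mult = (*), one = 1\<rparr>"

text \<open>A character is a pair of the idempotent \<open>x = |\<phi>|\<close> and a homomorphism on the group at \<open>x\<close>.
  Extensionality makes homomorphisms that agree on the group equal.\<close>

type_synonym 's chr = "'s \<times> ('s \<Rightarrow> complex)"

definition chars :: "'s::semigroup_mult chr set" where
  "chars = (SIGMA x:idems. hom (maxgroup x) cunits \<inter> extensional (carrier (maxgroup x)))"

definition lam :: "'s::semigroup_mult \<Rightarrow> 's \<Rightarrow> 's \<Rightarrow> 's" where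
  "lam y x = (\<lambda>s\<in>carrier (maxgroup x). y * s)"

definition sim_chars :: "('s::semigroup_mult chr \<times> 's chr) set" where
  "sim_chars = {(\<phi>, \<psi>). \<phi> \<in> chars \<and> \<psi> \<in> chars \<and> (fst \<phi>, fst \<psi>) \<in> simS
    \<and> (\<forall>s\<in>carrier (maxgroup (fst \<phi>)). snd \<phi> s = snd \<psi> (lam (fst \<psi>) (fst \<phi>) s))}"

definition chars_T :: "'s::semigroup_mult chr set set" where
  "chars_T = chars // sim_chars"

definition E_chr :: "'s::{semigroup_mult, finite} chr \<Rightarrow> 's semigroup_algebra" where
  "E_chr \<phi> = scale (1 / of_nat (card (carrier (maxgroup (fst \<phi>)))))
    (\<Sum>s\<in>carrier (maxgroup (fst \<phi>)). scale (cnj (snd \<phi> s)) (H s))"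

definition Q_chr :: "('s::lrbg set \<Rightarrow> 's semigroup_algebra) \<Rightarrow> 's chr \<Rightarrow> 's semigroup_algebra" where
  "Q_chr u \<phi> = E_chr \<phi> * Q_circ u (fst \<phi>)"

text \<open>The result does not depend on the representative chosen.\<close>

definition e_class :: "('s::lrbg set \<Rightarrow> 's semigroup_algebra) \<Rightarrow> 's chr set \<Rightarrow> 's semigroup_algebra" where
  "e_class u \<Phi> = (let \<phi> = (SOME \<phi>. \<phi> \<in> \<Phi>) in u (supp (fst \<phi>)) * Q_chr u \<phi>)"

section \<open>Group actions\<close>

text \<open>Here \<open>act w s\<close> is \<open>w \<cdot> s\<close>. Since \<open>act w\<close> is an automorphism, the action on a class in \<open>T\<close>
  is the image: \<open>act w ` supp s = supp (act w s)\<close>; likewise for classes of characters.\<close>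

definition act_chr ::
    "('w, 'm) monoid_scheme \<Rightarrow> ('w \<Rightarrow> 's \<Rightarrow> 's) \<Rightarrow> 'w \<Rightarrow> 's::semigroup_mult chr \<Rightarrow> 's chr" where
  "act_chr W act w \<phi> = (act w (fst \<phi>),
    \<lambda>s\<in>carrier (maxgroup (act w (fst \<phi>))). snd \<phi> (act (inv\<^bsub>W\<^esub> w) s))"

definition chars_T_orbits ::
    "('w, 'm) monoid_scheme \<Rightarrow> ('w \<Rightarrow> 's \<Rightarrow> 's) \<Rightarrow> 's::semigroup_mult chr set set set" where
  "chars_T_orbits W act = orbits W chars_T (\<lambda>w \<Phi>. act_chr W act w ` \<Phi>)"

definition e_orbit ::
    "('s::lrbg set \<Rightarrow> 's semigroup_algebra) \<Rightarrow> 's chr set set \<Rightarrow> 's semigroup_algebra" where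
  "e_orbit u \<Lambda> = (\<Sum>\<Phi>\<in>\<Lambda>. e_class u \<Phi>)"

definition invariant_section ::
    "('w, 'm) monoid_scheme \<Rightarrow> ('w \<Rightarrow> 's \<Rightarrow> 's) \<Rightarrow>
      ('s::{semigroup_mult, finite} set \<Rightarrow> 's semigroup_algebra) \<Rightarrow> bool" where
  "invariant_section W act u \<longleftrightarrow>
    (\<forall>w\<in>carrier W. \<forall>X\<in>idems_T. lin_ext (act w) (u X) = u (act w ` X))"

definition invariant_subalgebra ::
    "('w, 'm) monoid_scheme \<Rightarrow> ('w \<Rightarrow> 's \<Rightarrow> 's) \<Rightarrow> 's::{semigroup_mult, finite} semigroup_algebra set"
  where "invariant_subalgebra W act = {a. \<forall>w\<in>carrier W. lin_ext (act w) a = a}"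

section \<open>Complete systems of primitive orthogonal idempotents\<close>

definition primitive_idempotent :: "'a::ring set \<Rightarrow> 'a \<Rightarrow> bool" where
  "primitive_idempotent A e \<longleftrightarrow> e \<in> A \<and> e * e = e \<and> e \<noteq> 0 \<and>
    (\<forall>f\<in>A. \<forall>g\<in>A. f * f = f \<and> g * g = g \<and> f * g = 0 \<and> g * f = 0 \<and> e = f + g \<longrightarrow> f = 0 \<or> g = 0)"

definition is_identity :: "'a::ring set \<Rightarrow> 'a \<Rightarrow> bool" where
  "is_identity A i \<longleftrightarrow> i \<in> A \<and> (\<forall>a\<in>A. i * a = a \<and> a * i = a)"

text \<open>\<open>A\<close> is (the carrier of) a subalgebra. The algebra of an LRBG which is not a monoid may have
  no identity: if \<open>s * t = s\<close> for all \<open>s\<close>, \<open>t\<close>, then it only has right identities. Completeness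
  therefore means that the idempotents sum to a right identity of \<open>A\<close>, and to the
  identity of \<open>A\<close> whenever there is one. For unital \<open>A\<close> this is the usual notion
  (\<open>complete_system_unital\<close>).\<close>

definition complete_system :: "'a::ring set \<Rightarrow> 'i set \<Rightarrow> ('i \<Rightarrow> 'a) \<Rightarrow> bool" where
  "complete_system A I e \<longleftrightarrow> finite I
    \<and> (\<forall>i\<in>I. primitive_idempotent A (e i))
    \<and> (\<forall>i\<in>I. \<forall>j\<in>I. i \<noteq> j \<longrightarrow> e i * e j = 0)
    \<and> (\<forall>a\<in>A. a * (\<Sum>i\<in>I. e i) = a)
    \<and> (\<forall>i. is_identity A i \<longrightarrow> (\<Sum>i\<in>I. e i) = i)"

lemma complete_system_unital:
  assumes "is_identity A i"
  shows "complete_system A I e \<longleftrightarrow> finite I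
    \<and> (\<forall>i\<in>I. primitive_idempotent A (e i))
    \<and> (\<forall>i\<in>I. \<forall>j\<in>I. i \<noteq> j \<longrightarrow> e i * e j = 0)
    \<and> (\<Sum>i\<in>I. e i) = i"
proof -
  have "(\<forall>a\<in>A. a * e' = a) \<and> (\<forall>j. is_identity A j \<longrightarrow> e' = j) \<longleftrightarrow> e' = i" for e'
    using assms unfolding is_identity_def by metis
  then show ?thesis unfolding complete_system_def by blast
qed

end

theory Submission
  imports Defs "HOL-Algebra.FiniteProduct"
begin

text \<open>Every character class \<open>\<Phi>\<close> gives a multiplicative functional \<open>chi\<close> on the semigroup algebra: it kills
  the elements whose support is not below that of \<open>\<Phi>\<close>, and evaluates the character on the others after
  multiplying them into the maximal subgroup. These functionals detect idempotents: an idempotent on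
  which all of them vanish is zero. They take the values 0 and 1 on idempotents, the functional of \<open>\<Psi>\<close>
  maps \<open>e_class u \<Phi>\<close> to 1 if \<open>\<Phi> = \<Psi>\<close> and to 0 otherwise, and on invariant elements they are constant
  along each \<open>W\<close>-orbit. So in a decomposition of the orbit sum into two invariant idempotents one
  of the two is killed by all functionals, which is primitivity.
  Orthogonality and completeness both rest on \<open>H x * e_circ u Y = 0\<close> unless \<open>supp x\<close> is below \<open>Y\<close>.\<close>

section \<open>Linear algebra in the semigroup algebra\<close>

text \<open>The group parts are the obstacle: in a product of two \<open>e_class\<close> elements a
  factor from a group algebra stands between \<open>e_circ u X\<close> and
  \<open>e_circ u Y\<close>, so orthogonality of the \<open>e_circ\<close> elements alone is not
  enough. Vanishing is therefore proved with an arbitrary factor in between when \<open>X\<close> is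
  not below \<open>Y\<close>, and with a factor fixed by \<open>u Y\<close> on the left in the
  remaining case. Commutativity enters through one fact, that linear characters separate the points
  of a finite abelian group. It makes the elements \<open>E_chr \<phi>\<close> at one idempotent
  \<open>x\<close> sum to \<open>H x\<close>, hence gives completeness, and it makes the functionals
  detect idempotents, hence gives primitivity. The functionals live on the whole algebra, so nothing
  about the radical or the quotients of the invariant subalgebra has to be known. The algebra may
  lack a unit; identities are accordingly checked against basis elements, and the sum of the system
  is first shown to be a right identity.\<close>

lemma coeff_scale: "coeff (scale c a) s = c * coeff a s"
  by (simp add: scale_def Abs_semigroup_algebra_inverse)

lemma coeff_H: "coeff (H s) t = (if t = s then 1 else 0)"
  by (simp add: H_def Abs_semigroup_algebra_inverse)

lemma coeff_sum:
  "coeff (\<Sum>i\<in>I. f i) s = (\<Sum>i\<in>I. coeff (f i :: 's::{semigroup_mult, finite} semigroup_algebra) s)"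
  by (induction I rule: infinite_finite_induct) (simp_all add: coeff_zero coeff_add)

lemmas coeff_simps = coeff_zero coeff_add coeff_uminus coeff_diff coeff_scale coeff_H coeff_sum

lemma scale_zero_left: "scale 0 a = (0 :: 's::{semigroup_mult, finite} semigroup_algebra)"
  and scale_zero_right: "scale c (0 :: 's semigroup_algebra) = 0"
  and scale_one: "scale 1 (a :: 's semigroup_algebra) = a"
  and scale_scale: "scale c (scale d (a :: 's semigroup_algebra)) = scale (c * d) a"
  and scale_add_left: "scale (c + d) a = scale c a + (scale d a :: 's semigroup_algebra)"
  by (auto intro!: semigroup_algebra_eqI simp: coeff_simps algebra_simps)

lemma scale_sum_right:
  "scale c (\<Sum>i\<in>I. f i) = (\<Sum>i\<in>I. scale c (f i :: 's::{semigroup_mult, finite} semigroup_algebra))"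
  by (rule semigroup_algebra_eqI) (simp add: coeff_simps sum_distrib_left)

lemma scale_sum_left:
  "scale (\<Sum>i\<in>I. f i) a = (\<Sum>i\<in>I. scale (f i) (a :: 's::{semigroup_mult, finite} semigroup_algebra))"
  by (rule semigroup_algebra_eqI) (simp add: coeff_simps sum_distrib_right)

lemma scale_mult_left: "scale c a * b = scale c (a * b)"
  and scale_mult_right: "a * scale c b = scale c (a * b)"
  for a b :: "'s::{semigroup_mult, finite} semigroup_algebra"
  by (rule semigroup_algebra_eqI,
      simp add: coeff_mult coeff_scale sum_distrib_left if_distrib mult.assoc mult.left_commute cong: if_cong)+

lemma H_expansion: "(\<Sum>s\<in>UNIV. scale (coeff a s) (H s)) = a"
  for a :: "'s::{semigroup_mult, finite} semigroup_algebra"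
  by (rule semigroup_algebra_eqI) (simp add: coeff_simps if_distrib sum.delta cong: if_cong)

lemma mult_expand_left: "a * b = (\<Sum>s\<in>UNIV. scale (coeff a s) (H s * b))"
  for a b :: "'s::{semigroup_mult, finite} semigroup_algebra"
  by (subst H_expansion[of a, symmetric]) (simp only: sum_distrib_right scale_mult_left)

lemma mult_expand_right: "a * b = (\<Sum>s\<in>UNIV. scale (coeff b s) (a * H s))"
  for a b :: "'s::{semigroup_mult, finite} semigroup_algebra"
  by (subst H_expansion[of b, symmetric]) (simp only: sum_distrib_left scale_mult_right)

lemma scale_cong: "(c \<noteq> 0 \<Longrightarrow> a = b) \<Longrightarrow> scale c a = scale c (b :: 's::{semigroup_mult, finite} semigroup_algebra)"
  by (cases "c = 0") (simp_all add: scale_zero_left)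

text \<open>Only basis elements occurring in the left factor matter. This transfers facts about
  idempotents of a fixed support to the section element \<open>u X\<close>.\<close>

lemma mult_cong_supported:
  fixes a b c :: "'s::{semigroup_mult, finite} semigroup_algebra"
  assumes "\<And>s. coeff a s \<noteq> 0 \<Longrightarrow> H s * b = H s * c"
  shows "a * b = a * c"
  unfolding mult_expand_left[of a b] mult_expand_left[of a c]
  by (intro sum.cong refl scale_cong assms)

lemma mult_eq_zero_supported:
  fixes a b :: "'s::{semigroup_mult, finite} semigroup_algebra"
  assumes "\<And>s. coeff a s \<noteq> 0 \<Longrightarrow> H s * b = 0"
  shows "a * b = 0"
  using mult_cong_supported[of a b 0] assms by simp

lemma mult_eq_left_supported:
  fixes a b :: "'s::{semigroup_mult, finite} semigroup_algebra"
  assumes "\<And>s. coeff a s \<noteq> 0 \<Longrightarrow> H s * b = H s"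
  shows "a * b = a"
proof -
  have "a * b = (\<Sum>s\<in>UNIV. scale (coeff a s) (H s))"
    unfolding mult_expand_left[of a b]
    by (intro sum.cong refl scale_cong assms)
  then show ?thesis by (simp add: H_expansion)
qed

text \<open>Meant for a section element \<open>b\<close>: its coefficients sum to one, so if all
  basis elements in it act on \<open>a\<close> alike, so does \<open>b\<close>.\<close>

lemma mult_affine:
  fixes a b c :: "'s::{semigroup_mult, finite} semigroup_algebra"
  assumes "\<And>s. coeff b s \<noteq> 0 \<Longrightarrow> a * H s = c" and "(\<Sum>s\<in>UNIV. coeff b s) = 1"
  shows "a * b = c"
proof -
  have "a * b = (\<Sum>s\<in>UNIV. scale (coeff b s) c)"
    unfolding mult_expand_right[of a b]
    by (intro sum.cong refl scale_cong assms(1))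
  also have "\<dots> = c" by (simp add: scale_sum_left[symmetric] assms(2) scale_one)
  finally show ?thesis .
qed

section \<open>Linear extensions of maps of the basis\<close>

lemma coeff_lin_ext:
  "coeff (lin_ext f a) t = (\<Sum>s\<in>UNIV. if t = f s then coeff a s else 0)"
  by (simp add: lin_ext_def coeff_simps if_distrib cong: if_cong)

lemma lin_ext_H: "lin_ext f (H s) = H (f s)"
proof (rule semigroup_algebra_eqI)
  fix t
  have "coeff (lin_ext f (H s)) t = (\<Sum>r\<in>UNIV. if r = s then (if t = f s then 1 else 0) else 0)"
    unfolding coeff_lin_ext by (intro sum.cong refl) (auto simp: coeff_H)
  then show "coeff (lin_ext f (H s)) t = coeff (H (f s)) t" by (simp add: coeff_H)
qed

lemma lin_ext_add: "lin_ext f (a + b) = lin_ext f a + lin_ext f b"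
  by (simp add: lin_ext_def coeff_add scale_add_left sum.distrib)

lemma lin_ext_zero: "lin_ext f 0 = 0"
  by (simp add: lin_ext_def coeff_zero scale_zero_left)

lemma lin_ext_diff: "lin_ext f (a - b) = lin_ext f a - lin_ext f b"
  by (metis lin_ext_add diff_add_cancel add_diff_cancel_right')

lemma lin_ext_scale: "lin_ext f (scale c a) = scale c (lin_ext f a)"
  by (simp add: lin_ext_def coeff_scale scale_sum_right scale_scale)

lemma lin_ext_sum: "lin_ext f (\<Sum>i\<in>I. a i) = (\<Sum>i\<in>I. lin_ext f (a i))"
  by (induction I rule: infinite_finite_induct) (simp_all add: lin_ext_zero lin_ext_add)

lemma lin_ext_mult:
  fixes a b :: "'s::{semigroup_mult, finite} semigroup_algebra"
  assumes "\<And>s t. f (s * t) = f s * f t"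
  shows "lin_ext f (a * b) = lin_ext f a * lin_ext f b"
proof -
  have "lin_ext f (H s * b) = H (f s) * lin_ext f b" for s
    unfolding mult_expand_right[of "H s" b] 
    by (simp add: lin_ext_sum lin_ext_scale H_mult lin_ext_H assms)
      (simp add: lin_ext_def sum_distrib_left scale_mult_right H_mult)
  then show ?thesis
    unfolding mult_expand_left[of a b]
    by (simp add: lin_ext_sum lin_ext_scale) (simp add: lin_ext_def[of f a] sum_distrib_right scale_mult_left)
qed

section \<open>Left regular bands of groups\<close>

lemma omega_mult_self [simp]: "omega s * omega s = omega s"
  for s :: "'s::{semigroup_mult, finite}"
  by (metis omega_spow)

lemma omega_omega [simp]: "omega (omega s) = omega s"
  for s :: "'s::{semigroup_mult, finite}"
  by (simp add: omega_idem)

lemma omega_in_idems [simp]: "omega s \<in> idems"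
  for s :: "'s::{semigroup_mult, finite}"
  by (simp add: idems_def)

lemma idems_omega: "x \<in> idems \<Longrightarrow> omega x = x" for x :: "'s::semigroup_mult"
  by (simp add: idems_def omega_idem)

lemma idems_mult_self: "x \<in> idems \<Longrightarrow> x * x = x"
  by (simp add: idems_def)

lemma idem_regular: "x \<in> idems \<Longrightarrow> x * s * x = x * s" for x s :: "'s::lrbg"
  by (metis idems_omega omega_regular)

lemma mult_omega_cancel: "\<exists>t. s * t = omega s"
  for s :: "'s::{semigroup_mult, finite}"
proof -
  obtain n where n: "omega s = spow s n" by (rule omega_spow)
  show ?thesis
  proof (cases n)
    \<comment> \<open>The exponent is one here: \<open>s\<close> is itself idempotent and serves as
      its own partner.\<close>
    case 0
    then show ?thesis using n omega_mult_self[of s] by auto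
  next
    case (Suc m)
    then show ?thesis using n by auto
  qed
qed

text \<open>A second \<open>x\<close> is swallowed by regularity, so the powers of
  \<open>x * s\<close> are \<open>x\<close> times the powers of \<open>s\<close>, and the idempotent
  power is reached at the same exponent.\<close>

lemma omega_idem_mult:
  fixes x s :: "'s::lrbg"
  assumes "x \<in> idems"
  shows "omega (x * s) = x * omega s"
proof -
  have "spow (x * s) n = x * spow s n" for n
  proof (induction n)
    case (Suc n)
    have "spow (x * s) (Suc n) = x * s * x * spow s n" using Suc by (simp add: mult.assoc)
    also have "\<dots> = x * spow s (Suc n)"
      unfolding idem_regular[OF assms] by (simp add: mult.assoc)
    finally show ?case .
  qed simp
  moreover obtain n where "omega s = spow s n" by (rule omega_spow)
  moreover have "x * omega s * (x * omega s) = x * omega s"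
    using idem_regular[OF assms, of "omega s"] by (metis mult.assoc omega_mult_self)
  ultimately show ?thesis by (metis omega_eqI)
qed

text \<open>In general \<open>omega (s * t)\<close> differs from \<open>omega s * omega t\<close>: only the supports agree.\<close>

lemma absorb_omega_mult:
  fixes y s t :: "'s::lrbg"
  assumes y: "y \<in> idems"
  shows "y * omega (s * t) = y \<longleftrightarrow> y * omega s = y \<and> y * omega t = y"
proof
  let ?e = "omega (s * t)"
  assume L: "y * ?e = y"
  obtain n where n: "?e = spow (s * t) n" by (rule omega_spow)
  \<comment> \<open>As a power of \<open>s * t\<close>, the element \<open>?e\<close> ends in
    \<open>s * t\<close>, so it absorbs on the right whatever \<open>s * t\<close> absorbs.\<close>
  obtain p where p: "?e = s * t \<or> ?e = p * (s * t)"
    using n spow_Suc_right[of "s * t"] by (cases n) auto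
  have "s * t * omega s = s * t" by (rule omega_regular)
  moreover have "s * t * omega t = s * t" by (simp add: mult.assoc mult_omega)
  ultimately have "?e * omega s = ?e" "?e * omega t = ?e" using p by (auto simp: mult.assoc)
  then show "y * omega s = y \<and> y * omega t = y" using L by (metis mult.assoc)
next
  let ?e = "omega (s * t)"
  assume R: "y * omega s = y \<and> y * omega t = y"
  obtain s' t' where s': "s * s' = omega s" and t': "t * t' = omega t"
    using mult_omega_cancel by metis
  \<comment> \<open>Seen from \<open>y\<close>, this is a right inverse of \<open>s * t\<close>: the
    inner \<open>t * t'\<close> becomes \<open>omega t\<close>, which \<open>y * s\<close> absorbs,
    and then \<open>s * s'\<close> becomes \<open>omega s\<close>, which \<open>y\<close>
    absorbs.\<close>
  define w where "w = s * t * t' * s'"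
  have "y * s * omega t = y * s"
    using R idem_regular[OF y, of s] by (metis mult.assoc)
  then have "y * w = y"
    using R s' t' by (simp add: w_def) (metis mult.assoc)
  then have 1: "y * ?e * w = y"
    unfolding w_def by (metis mult.assoc omega_absorb)
  \<comment> \<open>The product \<open>y * ?e * y\<close> is evaluated in two ways: regularity
    reduces it to \<open>y * ?e\<close>, while the right inverse \<open>w\<close> turns it into
    \<open>y\<close>.\<close>
  have "y * ?e * y = y * ?e * (y * ?e * w)" using 1 by simp
  also have "\<dots> = y * ?e * w"
    using idem_regular[OF y, of ?e] by (metis mult.assoc omega_mult_self)
  finally show "y * ?e = y" using 1 idem_regular[OF y, of ?e] by simp
qed

section \<open>The partial order of supports\<close>

lemma supp_idem_eq_iff:
  fixes x y :: "'s::lrbg"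
  assumes "x \<in> idems" "y \<in> idems"
  shows "supp x = supp y \<longleftrightarrow> x * y = x \<and> y * x = y"
  using assms by (simp add: supp_eq_iff simS_iff idems_omega)

lemma less_eq_T_idems_T: "less_eq_T X Y \<Longrightarrow> X \<in> idems_T" "less_eq_T X Y \<Longrightarrow> Y \<in> idems_T"
  by (simp_all add: less_eq_T_def)

lemma less_T_idems_T: "less_T X Y \<Longrightarrow> X \<in> idems_T" "less_T X Y \<Longrightarrow> Y \<in> idems_T"
  by (simp_all add: less_T_def less_eq_T_def)

lemma supp_in_idems_T: "x \<in> idems \<Longrightarrow> supp x \<in> idems_T"
  by (simp add: idems_T_def)

lemma idems_T_cases:
  assumes "X \<in> idems_T" obtains x where "x \<in> idems" "X = supp x"
  using assms by (auto simp: idems_T_def)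

lemma less_eq_T_refl: "X \<in> idems_T \<Longrightarrow> less_eq_T X X" for X :: "'s::lrbg set"
  by (metis idems_T_cases less_eq_T_supp idems_mult_self)

lemma less_eq_T_antisym: "less_eq_T X Y \<Longrightarrow> less_eq_T Y X \<Longrightarrow> X = Y" for X Y :: "'s::lrbg set"
  by (metis less_T_def less_T_trans)

text \<open>Induction runs downwards from the maximal supports, matching the recursion of
  \<open>e_circ\<close>.\<close>

lemma less_T_induct [consumes 1, case_names step]:
  fixes X :: "'s::lrbg set"
  assumes "X \<in> idems_T"
    and step: "\<And>X. X \<in> idems_T \<Longrightarrow> (\<And>Y. less_T X Y \<Longrightarrow> P Y) \<Longrightarrow> P X"
  shows "P X"
  using assms(1)
proof (induction "card {Z. less_T X Z}" arbitrary: X rule: less_induct)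
  case less
  show ?case
  proof (rule step[OF less.prems])
    fix Y assume XY: "less_T X Y"
    then have "{Z. less_T Y Z} \<subset> {Z. less_T X Z}"
      using less_T_trans by (auto simp: less_T_def)
    then show "P Y"
      using less.hyps less_T_idems_T(2)[OF XY] by (simp add: psubset_card_mono)
  qed
qed

section \<open>Characters of finite abelian groups\<close>

lemma group_cunits: "group cunits"
proof (rule groupI)
  fix x assume "x \<in> carrier cunits"
  then show "\<exists>y\<in>carrier cunits. y \<otimes>\<^bsub>cunits\<^esub> x = \<one>\<^bsub>cunits\<^esub>"
    by (intro bexI[of _ "inverse x"]) (auto simp: cunits_def)
qed (auto simp: cunits_def)

context group
begin

lemma hom_cunits_mult:
  "\<chi> \<in> hom G cunits \<Longrightarrow> x \<in> carrier G \<Longrightarrow> y \<in> carrier G \<Longrightarrow> \<chi> (x \<otimes> y) = \<chi> x * \<chi> y"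
  by (simp add: hom_def cunits_def)

lemma hom_cunits_nonzero: "\<chi> \<in> hom G cunits \<Longrightarrow> x \<in> carrier G \<Longrightarrow> \<chi> x \<noteq> 0"
  by (auto simp: hom_def cunits_def)

lemma hom_cunits_one: "\<chi> \<in> hom G cunits \<Longrightarrow> \<chi> \<one> = 1"
  using hom_one[OF _ is_group group_cunits, of \<chi>] by (simp add: cunits_def)

lemma translate_bij: "x \<in> carrier G \<Longrightarrow> bij_betw (\<lambda>g. x \<otimes> g) (carrier G) (carrier G)"
  and translate_right_bij: "x \<in> carrier G \<Longrightarrow> bij_betw (\<lambda>g. g \<otimes> x) (carrier G) (carrier G)"
  by (rule bij_betw_byWitness[where f' = "\<lambda>g. inv x \<otimes> g"], auto simp: m_assoc[symmetric])
    (rule bij_betw_byWitness[where f' = "\<lambda>g. g \<otimes> inv x"], auto simp: m_assoc)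

text \<open>Translation by \<open>x\<close> permutes the group, so it leaves the product of all
  values of the character unchanged, yet multiplies it by this power.\<close>

lemma hom_cunits_pow_order:
  assumes "\<chi> \<in> hom G cunits" "x \<in> carrier G" "finite (carrier G)"
  shows "\<chi> x ^ order G = 1"
proof -
  let ?P = "\<Prod>g\<in>carrier G. \<chi> g"
  have "?P = (\<Prod>g\<in>carrier G. \<chi> (x \<otimes> g))"
    by (rule prod.reindex_bij_betw[OF translate_bij[OF assms(2)], symmetric])
  also have "\<dots> = \<chi> x ^ order G * ?P"
    using assms by (simp add: hom_cunits_mult prod.distrib order_def)
  finally show ?thesis using assms by (simp add: hom_cunits_nonzero)
qed

text \<open>All values are roots of unity of one fixed order, which leaves finitely many
  candidates.\<close>

lemma finite_hom_cunits:
  assumes "finite (carrier G)"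
  shows "finite (hom G cunits \<inter> extensional (carrier G))"
proof (rule finite_subset)
  show "hom G cunits \<inter> extensional (carrier G) \<subseteq> carrier G \<rightarrow>\<^sub>E {z. z ^ order G = 1}"
    using assms hom_cunits_pow_order by (auto simp: PiE_def)
  have "order G > 0" using assms by (simp add: order_gt_0_iff_finite)
  then have "finite {z :: complex. z ^ order G = 1}"
    using bij_betw_finite[OF bij_betw_roots_unity] by auto
  then show "finite (carrier G \<rightarrow>\<^sub>E {z :: complex. z ^ order G = 1})"
    using assms by (intro finite_PiE)
qed

lemma hom_cunits_norm:
  assumes "\<chi> \<in> hom G cunits" "x \<in> carrier G" "finite (carrier G)"
  shows "norm (\<chi> x) = 1"
proof -
  have "norm (\<chi> x) ^ order G = 1 ^ order G"
    using hom_cunits_pow_order[OF assms] by (simp add: norm_power[symmetric])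
  moreover have "order G > 0" using assms by (simp add: order_gt_0_iff_finite)
  ultimately show ?thesis by (metis norm_ge_zero power_eq_imp_eq_base zero_le_one)
qed

lemma hom_cunits_cnj:
  assumes "\<chi> \<in> hom G cunits" "x \<in> carrier G" "finite (carrier G)"
  shows "cnj (\<chi> x) * \<chi> x = 1"
  using hom_cunits_norm[OF assms] complex_norm_square[of "\<chi> x"] by (simp add: mult.commute)

text \<open>For distinct characters, translation by an element where they differ multiplies the sum
  by a number other than 1 without changing it.\<close>

lemma character_orthogonality:
  assumes \<chi>: "\<chi> \<in> hom G cunits \<inter> extensional (carrier G)"
    and \<psi>: "\<psi> \<in> hom G cunits \<inter> extensional (carrier G)" and fin: "finite (carrier G)"
  shows "(\<Sum>g\<in>carrier G. cnj (\<psi> g) * \<chi> g) = (if \<chi> = \<psi> then of_nat (card (carrier G)) else 0)"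
proof (cases "\<chi> = \<psi>")
  case True
  then have "(\<Sum>g\<in>carrier G. cnj (\<psi> g) * \<chi> g) = (\<Sum>g\<in>carrier G. 1)"
    using \<psi> fin by (intro sum.cong refl) (simp add: hom_cunits_cnj)
  then show ?thesis using True by simp
next
  case False
  then obtain x where x: "x \<in> carrier G" "\<chi> x \<noteq> \<psi> x"
    using \<chi> \<psi> extensionalityI[of \<chi> "carrier G" \<psi>] by blast
  have chars: "\<chi> \<in> hom G cunits" "\<psi> \<in> hom G cunits" using \<chi> \<psi> by auto
  let ?S = "\<Sum>g\<in>carrier G. cnj (\<psi> g) * \<chi> g"
  have "?S = (\<Sum>g\<in>carrier G. cnj (\<psi> (x \<otimes> g)) * \<chi> (x \<otimes> g))"
    by (rule sum.reindex_bij_betw[OF translate_bij[OF x(1)], symmetric])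
  also have "\<dots> = (cnj (\<psi> x) * \<chi> x) * ?S"
    using chars x by (simp add: hom_cunits_mult sum_distrib_left mult.assoc mult.left_commute)
  finally have eq: "?S = (cnj (\<psi> x) * \<chi> x) * ?S" .
  have "cnj (\<psi> x) * \<chi> x \<noteq> cnj (\<psi> x) * \<psi> x"
    using x hom_cunits_nonzero[OF chars(2)] by simp
  then have "?S = 0" using eq hom_cunits_cnj[OF chars(2) x(1) fin] by auto
  then show ?thesis using False by simp
qed

end

text \<open>A geometric sum; \<open>j < n\<close> makes its ratio different from 1 unless
  \<open>j = 0\<close>. It recovers a function from its projections onto the eigenspaces of a
  translation.\<close>

lemma sum_root_unity_powers:
  fixes n j :: nat
  assumes "j < n"
  shows "(\<Sum>k<n. cis (2 * pi * real k / real n) ^ j) = (if j = 0 then of_nat n else 0)"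
proof (cases "j = 0")
  case False
  let ?z = "cis (2 * pi * real j / real n)"
  have n: "n > 0" using assms by simp
  have "inj_on (\<lambda>k. cis (2 * pi * real k / real n)) {..<n}"
    using bij_betw_roots_unity[OF n] by (simp add: bij_betw_def)
  from inj_onD[OF this, of j 0] have "?z \<noteq> 1" using assms n False by auto
  moreover have "?z ^ n = 1"
    using n bij_betw_roots_unity[OF n] assms by (auto simp: bij_betw_def)
  ultimately have "(\<Sum>k<n. ?z ^ k) = 0" by (simp add: geometric_sum)
  moreover have "cis (2 * pi * real k / real n) ^ j = ?z ^ k" for k
    by (simp add: DeMoivre algebra_simps)
  ultimately show ?thesis using False by simp
qed simp

context comm_group
begin

text \<open>The averages of \<open>f\<close> over the powers of one group element, weighted by roots of unity, are
  eigenvectors of its translation and sum to a multiple of \<open>f\<close>; doing this for one element after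
  the other yields a common eigenvector, which is proportional to a character.\<close>

lemma translation_eigenvector:
  assumes fin: "finite (carrier G)" and "finite B" "B \<subseteq> carrier G"
    and "\<forall>\<chi>\<in>hom G cunits \<inter> extensional (carrier G). (\<Sum>g\<in>carrier G. f g * \<chi> g) = 0"
    and "\<exists>g\<in>carrier G. f g \<noteq> (0 :: complex)"
  shows "\<exists>f'. (\<forall>\<chi>\<in>hom G cunits \<inter> extensional (carrier G). (\<Sum>g\<in>carrier G. f' g * \<chi> g) = 0)
    \<and> (\<exists>g\<in>carrier G. f' g \<noteq> 0) \<and> (\<forall>b\<in>B. \<exists>z. \<forall>g\<in>carrier G. f' (g \<otimes> b) = z * f' g)"
  using assms(2,3)
proof (induction B)
  case empty
  then show ?case using assms by auto
next
  case (insert a B)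
  let ?K = "\<lambda>f. \<forall>\<chi>\<in>hom G cunits \<inter> extensional (carrier G). (\<Sum>g\<in>carrier G. f g * \<chi> g) = (0 :: complex)"
  have a: "a \<in> carrier G" and B: "B \<subseteq> carrier G" using insert by auto
  obtain f where K: "?K f" and nz: "\<exists>g\<in>carrier G. f g \<noteq> 0"
    and eig: "\<forall>b\<in>B. \<exists>z. \<forall>g\<in>carrier G. f (g \<otimes> b) = z * f g"
    using insert.IH[OF B] by blast
  define n where "n = order G"
  have n: "n > 0" using fin by (simp add: n_def order_gt_0_iff_finite)
  \<comment> \<open>For \<open>w\<close> an \<open>n\<close>-th root of unity, \<open>F w\<close> is
    \<open>n\<close> times the projection of \<open>f\<close> onto the eigenspace of translation by
    \<open>a\<close> with eigenvalue \<open>inverse w\<close>.\<close>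
  define F where "F w g = (\<Sum>j<n. w ^ j * f (g \<otimes> a [^] j))" for w g
  define r where "r k = cis (2 * pi * real k / real n)" for k :: nat
  have rn: "r k ^ n = 1" if "k < n" for k
    using that bij_betw_roots_unity[OF n] by (auto simp: bij_betw_def r_def)
  have sumF: "(\<Sum>k<n. F (r k) g) = of_nat n * f g" if g: "g \<in> carrier G" for g
  proof -
    have "(\<Sum>k<n. F (r k) g) = (\<Sum>j<n. (\<Sum>k<n. r k ^ j) * f (g \<otimes> a [^] j))"
      unfolding F_def by (subst sum.swap) (simp add: sum_distrib_right)
    also have "\<dots> = (\<Sum>j<n. if j = 0 then of_nat n * f g else 0)"
      using g by (intro sum.cong refl) (simp add: r_def sum_root_unity_powers)
    also have "\<dots> = of_nat n * f g" using n by simp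
    finally show ?thesis .
  qed
  obtain g0 where g0: "g0 \<in> carrier G" "f g0 \<noteq> 0" using nz by blast
  \<comment> \<open>The projections sum to a nonzero multiple of \<open>f\<close>, so one of them
    survives at \<open>g0\<close>.\<close>
  have "\<exists>k<n. F (r k) g0 \<noteq> 0"
  proof (rule ccontr)
    assume "\<not> ?thesis"
    then have "(\<Sum>k<n. F (r k) g0) = 0" by simp
    then show False using sumF[OF g0(1)] n g0 by simp
  qed
  then obtain k where k: "k < n" and Fnz: "F (r k) g0 \<noteq> 0" by blast
  let ?w = "r k" let ?f = "F (r k)"
  have wn: "?w ^ n = 1" by (rule rn[OF k])
  have w0: "?w \<noteq> 0" by (simp add: r_def)
  have an: "a [^] n = \<one>" using a fin by (simp add: n_def order_def power_order_eq_one)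
  have eig_a: "?f (g \<otimes> a) = inverse ?w * ?f g" if g: "g \<in> carrier G" for g
  proof -
    let ?t = "\<lambda>j. ?w ^ j * f (g \<otimes> a [^] j)"
    have "?w * ?f (g \<otimes> a) = (\<Sum>j<n. ?t (Suc j))"
      unfolding F_def sum_distrib_left
      using g a by (intro sum.cong refl) (simp add: m_assoc nat_pow_Suc2[symmetric] del: nat_pow_Suc)
    \<comment> \<open>The index shift is cyclic: the term at \<open>n\<close> equals the one at 0,
      since \<open>n\<close> is an exponent of both \<open>?w\<close> and \<open>a\<close>.\<close>
    also have "\<dots> = (\<Sum>j<Suc n. ?t j) - ?t 0" by (subst sum.lessThan_Suc_shift) simp
    also have "\<dots> = ?f g" using g wn an by (simp add: F_def)
    finally show ?thesis using w0 by (simp add: field_simps)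
  qed
  have eig_B: "\<exists>z. \<forall>g\<in>carrier G. ?f (g \<otimes> b) = z * ?f g" if b: "b \<in> B" for b
  proof -
    obtain z where z: "\<forall>g\<in>carrier G. f (g \<otimes> b) = z * f g" using eig b by blast
    have "?f (g \<otimes> b) = z * ?f g" if g: "g \<in> carrier G" for g
    proof -
      \<comment> \<open>Translations commute, so passing to an eigenvector for \<open>a\<close>
        keeps the eigenvector property for the elements treated before.\<close>
      have "f (g \<otimes> b \<otimes> a [^] j) = z * f (g \<otimes> a [^] j)" for j :: nat
      proof -
        have "g \<otimes> b \<otimes> a [^] j = g \<otimes> a [^] j \<otimes> b"
          using a subsetD[OF B b] g by (simp add: m_ac)
        then show ?thesis using z g a by simp
      qed
      then show ?thesis unfolding F_def by (simp add: sum_distrib_left mult.left_commute)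
    qed
    then show ?thesis by blast
  qed
  have "?K ?f"
  proof
    fix \<chi> assume \<chi>: "\<chi> \<in> hom G cunits \<inter> extensional (carrier G)"
    \<comment> \<open>Translating \<open>f\<close> only scales its pairing with a character, so all
      translates remain orthogonal to it.\<close>
    have trans: "(\<Sum>g\<in>carrier G. f (g \<otimes> b) * \<chi> g) = 0" if b: "b \<in> carrier G" for b
    proof -
      have "\<chi> b * (\<Sum>g\<in>carrier G. f (g \<otimes> b) * \<chi> g) = (\<Sum>g\<in>carrier G. f (g \<otimes> b) * \<chi> (g \<otimes> b))"
        using \<chi> b by (simp add: sum_distrib_left hom_cunits_mult mult_ac)
      also have "\<dots> = (\<Sum>g\<in>carrier G. f g * \<chi> g)"
        by (rule sum.reindex_bij_betw[OF translate_right_bij[OF b]])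
      also have "\<dots> = 0" using K \<chi> by blast
      finally show ?thesis using \<chi> b hom_cunits_nonzero by auto
    qed
    have "(\<Sum>g\<in>carrier G. ?f g * \<chi> g)
        = (\<Sum>j<n. ?w ^ j * (\<Sum>g\<in>carrier G. f (g \<otimes> a [^] j) * \<chi> g))"
      unfolding F_def sum_distrib_right
      by (subst sum.swap) (simp add: sum_distrib_left mult.assoc)
    then show "(\<Sum>g\<in>carrier G. ?f g * \<chi> g) = 0" using a trans by simp
  qed
  moreover have "\<forall>b\<in>insert a B. \<exists>z. \<forall>g\<in>carrier G. ?f (g \<otimes> b) = z * ?f g"
    using eig_a eig_B by blast
  ultimately show ?case using Fnz g0 by blast
qed

text \<open>A nonzero counterexample could be replaced by a common eigenvector of all translations.
  Its eigenvalues form a character, and its pairing with the conjugate character is the group order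
  times a nonzero constant.\<close>

lemma characters_separate:
  fixes f :: "'a \<Rightarrow> complex"
  assumes fin: "finite (carrier G)"
    and "\<And>\<chi>. \<chi> \<in> hom G cunits \<inter> extensional (carrier G) \<Longrightarrow> (\<Sum>g\<in>carrier G. f g * \<chi> g) = 0"
    and "g \<in> carrier G"
  shows "f g = 0"
proof (rule ccontr)
  assume "f g \<noteq> 0"
  then obtain f' where K: "\<And>\<chi>. \<chi> \<in> hom G cunits \<inter> extensional (carrier G)
        \<Longrightarrow> (\<Sum>g\<in>carrier G. f' g * \<chi> g) = (0 :: complex)"
    and nz: "\<exists>g\<in>carrier G. f' g \<noteq> 0"
    and "\<forall>b\<in>carrier G. \<exists>z. \<forall>g\<in>carrier G. f' (g \<otimes> b) = z * f' g"
    using translation_eigenvector[OF fin fin subset_refl, of f] assms by blast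
  then obtain z where z: "\<And>g b. b \<in> carrier G \<Longrightarrow> g \<in> carrier G \<Longrightarrow> f' (g \<otimes> b) = z b * f' g"
    by metis
  have f'_z: "f' b = z b * f' \<one>" if "b \<in> carrier G" for b
    using z[OF that one_closed] that by simp
  then have f1: "f' \<one> \<noteq> 0" using nz by force
  have z_mult: "z (a \<otimes> b) = z a * z b" if "a \<in> carrier G" "b \<in> carrier G" for a b
    using z[OF that(2,1)] f'_z[OF that(1)] f'_z[of "a \<otimes> b"] that f1 by simp
  have z_one: "z \<one> = 1" using f'_z[OF one_closed] f1 by simp
  have z_nz: "z a \<noteq> 0" if "a \<in> carrier G" for a
    using z_mult[of a "inv a"] that z_one by auto
  define \<chi> where "\<chi> = (\<lambda>g\<in>carrier G. cnj (z g))"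
  have "\<chi> \<in> hom G cunits"
    using z_mult z_nz by (auto simp: \<chi>_def hom_def cunits_def)
  moreover have z_hom: "z \<in> hom G cunits"
    using z_mult z_nz by (auto simp: hom_def cunits_def)
  moreover have "\<chi> \<in> extensional (carrier G)" by (simp add: \<chi>_def)
  ultimately have "(\<Sum>g\<in>carrier G. f' g * \<chi> g) = 0" by (intro K) blast
  moreover have "(\<Sum>g\<in>carrier G. f' g * \<chi> g) = (\<Sum>g\<in>carrier G. f' \<one>)"
  proof (intro sum.cong refl)
    fix g assume g: "g \<in> carrier G"
    then have "f' g * \<chi> g = f' \<one> * (cnj (z g) * z g)" using f'_z[OF g] by (simp add: \<chi>_def)
    then show "f' g * \<chi> g = f' \<one>" using hom_cunits_cnj[OF z_hom g fin] by simp
  qed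
  ultimately show False using f1 fin by (auto simp: order_gt_0_iff_finite)
qed

end

section \<open>The idempotents of a homogeneous section\<close>

locale homogeneous =
  fixes u :: "'s::lrbg set \<Rightarrow> 's semigroup_algebra"
  assumes homogeneous: "homogeneous_section u"
begin

abbreviation e :: "'s set \<Rightarrow> 's semigroup_algebra" where "e \<equiv> e_circ u"

lemma coeff_u:
  assumes "X \<in> idems_T"
  shows "coeff (u X) s \<noteq> 0 \<Longrightarrow> s \<in> idems \<and> supp s = X"
    and "(\<Sum>s\<in>UNIV. coeff (u X) s) = 1"
proof -
  let ?A = "{x. x \<in> idems \<and> supp x = X}"
  obtain c where u: "u X = (\<Sum>x\<in>?A. scale (c x) (H x))" and c: "sum c ?A = 1"
    using assms homogeneous unfolding homogeneous_section_def by blast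
  have coeff: "coeff (u X) s = (if s \<in> ?A then c s else 0)" for s
    unfolding u by (simp add: coeff_simps if_distrib sum.delta cong: if_cong)
  show "coeff (u X) s \<noteq> 0 \<Longrightarrow> s \<in> idems \<and> supp s = X" by (auto simp: coeff split: if_splits)
  show "(\<Sum>s\<in>UNIV. coeff (u X) s) = 1"
    unfolding coeff by (simp add: sum.If_cases c)
qed

text \<open>Idempotents \<open>x\<close>, \<open>y\<close> of equal support satisfy
  \<open>x * y = x\<close>, so every term of the section acts on \<open>H x\<close> trivially and
  the coefficients sum to one.\<close>

lemma H_mult_u: "x \<in> idems \<Longrightarrow> H x * u (supp x) = H x"
  by (rule mult_affine)
    (auto simp: H_mult coeff_u(2) supp_in_idems_T supp_idem_eq_iff dest!: coeff_u(1)[rotated])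

lemma u_mult_H: "x \<in> idems \<Longrightarrow> u (supp x) * H x = u (supp x)"
  by (rule mult_eq_left_supported)
    (auto simp: H_mult supp_in_idems_T supp_idem_eq_iff dest!: coeff_u(1)[rotated])

lemma u_mult_u:
  assumes "X \<in> idems_T" shows "u X * u X = u X"
proof (rule mult_eq_left_supported)
  fix s assume "coeff (u X) s \<noteq> 0"
  then have "s \<in> idems" "supp s = X" using coeff_u(1)[OF assms] by auto
  then show "H s * u X = H s" using H_mult_u[of s] by simp
qed

lemma e_unfold: "e X = u X - u X * (\<Sum>Y | less_T X Y. e Y)"
  by (subst e_circ.simps) (simp add: sum_distrib_left)

lemma u_mult_e: "X \<in> idems_T \<Longrightarrow> u X * e X = e X"
  by (simp add: e_unfold[of X] right_diff_distrib mult.assoc[symmetric] u_mult_u)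

text \<open>This is the defining recursion of \<open>e_circ\<close> with the subtracted terms moved
  to the other side.\<close>

lemma u_mult_sum_e:
  assumes "X \<in> idems_T"
  shows "u X * (\<Sum>Y | less_eq_T X Y. e Y) = u X"
proof -
  have "{Y. less_eq_T X Y} = insert X {Y. less_T X Y}"
    using assms less_eq_T_refl by (auto simp: less_T_def)
  then have "(\<Sum>Y | less_eq_T X Y. e Y) = e X + (\<Sum>Y | less_T X Y. e Y)"
    by (simp add: less_T_def)
  then show ?thesis
    using u_mult_e[OF assms] e_unfold[of X] by (simp add: distrib_left)
qed

lemma H_mult_sum_e:
  assumes "x \<in> idems"
  shows "H x * (\<Sum>Y | less_eq_T (supp x) Y. e Y) = H x"
  using u_mult_sum_e[OF supp_in_idems_T[OF assms]] H_mult_u[OF assms]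
  by (metis mult.assoc)

lemma sum_e_supported:
  assumes "\<And>Z. Z \<in> A - B \<Longrightarrow> a * e Z = 0" and "B \<subseteq> A"
  shows "a * (\<Sum>Z\<in>A. e Z) = a * (\<Sum>Z\<in>B. e Z)"
  unfolding sum_distrib_left by (rule sum.mono_neutral_right) (use assms in auto)

text \<open>Multiplying \<open>u Y\<close> by \<open>H x\<close> pushes every basis element strictly
  above \<open>Y\<close>. Each such element is fixed on the right by the sum of \<open>e Z\<close>
  over \<open>Z\<close> above \<open>Y\<close>, so the two terms of the recursion for
  \<open>e Y\<close> cancel.\<close>

lemma H_mult_e_eq_0:
  assumes "Y \<in> idems_T" "x \<in> idems" "\<not> less_eq_T (supp x) Y"
  shows "H x * e Y = 0"
  using assms
proof (induction Y arbitrary: x rule: less_T_induct)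
  case (step Y)
  note Y = \<open>Y \<in> idems_T\<close> and x = \<open>x \<in> idems\<close> and IH = step.IH
  have "H x * (u Y * (\<Sum>Z | less_T Y Z. e Z)) = H x * u Y"
  proof -
    have "H y * (\<Sum>Z | less_T Y Z. e Z) = H y" if nz: "coeff (H x * u Y) y \<noteq> 0" for y
    proof -
      obtain y' where "coeff (u Y) y' \<noteq> 0" and y: "y = x * y'"
      proof -
        have "\<exists>s t. y = s * t \<and> coeff (H x) s \<noteq> 0 \<and> coeff (u Y) t \<noteq> 0"
        proof (rule ccontr)
          assume "\<not> ?thesis"
          then have "coeff (H x * u Y) y = 0"
            unfolding coeff_mult by (intro sum.neutral ballI) auto
          then show False using nz by simp
        qed
        then show ?thesis using that by (auto simp: coeff_H split: if_splits)
      qed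
      then have y': "y' \<in> idems" "supp y' = Y" using coeff_u(1)[OF Y] by blast+
      have yi: "y \<in> idems"
        using idem_regular[OF x, of y'] idems_mult_self[OF y'(1)]
        unfolding y idems_def by (simp add: mult.assoc[symmetric]) (simp add: mult.assoc)
      have "y * y' = y" using idems_mult_self[OF y'(1)] by (simp add: y mult.assoc)
      then have Yy: "less_eq_T Y (supp y)" using y' yi less_eq_T_supp by blast
      \<comment> \<open>Equal supports would give \<open>y' * x = y'\<close>, placing
        \<open>supp x\<close> below \<open>Y\<close>.\<close>
      have "Y \<noteq> supp y"
      proof
        assume "Y = supp y"
        then have "y' * y = y'" using y' yi supp_idem_eq_iff by blast
        then have "y' * x = y'"
          using idem_regular[OF y'(1), of x] by (simp add: y mult.assoc[symmetric])
        then show False using step.prems y' less_eq_T_supp[OF x y'(1)] by simp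
      qed
      with Yy have Yy': "less_T Y (supp y)" by (simp add: less_T_def)
      \<comment> \<open>The induction hypothesis removes the \<open>Z\<close> that are not above
        \<open>supp y\<close>; the remaining sum fixes \<open>H y\<close>.\<close>
      have "H y * (\<Sum>Z | less_T Y Z. e Z) = H y * (\<Sum>Z | less_eq_T (supp y) Z. e Z)"
      proof (rule sum_e_supported)
        show "{Z. less_eq_T (supp y) Z} \<subseteq> {Z. less_T Y Z}"
          using Yy' less_T_trans[OF Yy'] by (auto simp: less_T_def)
      qed (use IH yi in blast)
      then show ?thesis using H_mult_sum_e[OF yi] by simp
    qed
    then show ?thesis by (simp add: mult_eq_left_supported mult.assoc[symmetric])
  qed
  then show ?case by (simp add: e_unfold[of Y] right_diff_distrib)
qed

text \<open>Supports only grow under multiplication: if the support of \<open>omega (x * s)\<close>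
  were below \<open>Y\<close>, so would be that of \<open>x\<close>. Hence any factor may be
  inserted.\<close>

lemma H_mult_mult_e_eq_0:
  assumes "Y \<in> idems_T" "x \<in> idems" "\<not> less_eq_T (supp x) Y"
  shows "H x * (a * e Y) = 0"
proof -
  obtain y where y: "y \<in> idems" "Y = supp y" using assms(1) by (rule idems_T_cases)
  have "H s * e Y = 0" if "\<not> less_eq_T (supp (omega s)) Y" for s
  proof -
    have "H s * e Y = H s * (H (omega s) * e Y)"
      by (simp add: mult.assoc[symmetric] H_mult mult_omega)
    then show ?thesis using H_mult_e_eq_0[OF assms(1) omega_in_idems that] by simp
  qed
  moreover have "\<not> less_eq_T (supp (omega (x * s))) Y" for s
    using assms(2,3) y absorb_omega_mult[OF y(1)]
    by (simp add: less_eq_T_supp idems_omega)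
  ultimately have "H x * H s * e Y = 0" for s by (simp add: H_mult)
  then have "H x * a * e Y = 0"
    unfolding mult_expand_right[of "H x" a]
    by (simp add: sum_distrib_right scale_mult_left scale_zero_right)
  then show ?thesis by (simp add: mult.assoc)
qed

lemma e_mult_mult_e_eq_0:
  assumes "X \<in> idems_T" "Y \<in> idems_T" "\<not> less_eq_T X Y"
  shows "e X * (a * e Y) = 0"
proof -
  have "u X * (b * e Y) = 0" for b
  proof (rule mult_eq_zero_supported)
    fix s assume "coeff (u X) s \<noteq> 0"
    then have "s \<in> idems" "supp s = X" using coeff_u(1)[OF assms(1)] by auto
    then show "H s * (b * e Y) = 0" using H_mult_mult_e_eq_0 assms by blast
  qed
  then have "u X * (e X * a * e Y) = 0" by blast
  moreover have "u X * (e X * a * e Y) = u X * e X * (a * e Y)" by (simp add: mult.assoc)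
  ultimately show ?thesis by (simp add: u_mult_e[OF assms(1)])
qed

text \<open>Unfolding the left \<open>e X\<close> leaves \<open>u X\<close>, because the correction
  terms belong to supports strictly above \<open>X\<close> and vanish. The hypothesis on
  \<open>a\<close> holds for \<open>u X * E_chr \<phi>\<close>, the intended factor.\<close>

lemma e_mult_mult_e_same:
  assumes X: "X \<in> idems_T" and a: "u X * a = a"
  shows "e X * (a * e X) = a * e X"
proof -
  have "e Z * (a * e X) = 0" if "less_T X Z" for Z
    using e_mult_mult_e_eq_0[of Z X] that less_T_idems_T[OF that] less_eq_T_antisym
    unfolding less_T_def by blast
  then have "(\<Sum>Z | less_T X Z. e Z) * (a * e X) = 0"
    by (simp add: sum_distrib_right)
  then have "e X * (a * e X) = u X * (a * e X)"
    by (subst e_unfold) (simp add: left_diff_distrib mult.assoc)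
  then show ?thesis using a by (simp add: mult.assoc[symmetric])
qed

text \<open>For \<open>X\<close> below \<open>Y\<close>, unfold the left \<open>e X\<close>: by
  induction only the correction term at \<open>Y\<close> survives, and it reproduces
  \<open>a * e Y\<close>, cancelling the leading term.\<close>

lemma e_mult_mult_e_distinct:
  assumes "X \<in> idems_T" "Y \<in> idems_T" "X \<noteq> Y" and a: "u Y * a = a"
  shows "e X * (a * e Y) = 0"
  using assms(1,3)
proof (induction X rule: less_T_induct)
  case (step X)
  note X = \<open>X \<in> idems_T\<close>
  show ?case
  proof (cases "less_eq_T X Y")
    case False
    then show ?thesis using e_mult_mult_e_eq_0[OF X assms(2)] by blast
  next
    case True
    then have XY: "less_T X Y" using step.prems by (simp add: less_T_def)
    have "e Z * (a * e Y) = 0" if XZ: "less_T X Z" and "Z \<noteq> Y" for Z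
      using step.IH[OF XZ] that by blast
    then have "(\<Sum>Z | less_T X Z. e Z) * (a * e Y) = (\<Sum>Z | less_T X Z. if Z = Y then a * e Y else 0)"
      unfolding sum_distrib_right
      by (intro sum.cong refl) (auto simp: e_mult_mult_e_same[OF assms(2) a])
    also have "\<dots> = a * e Y" using XY by simp
    finally show ?thesis
      by (subst e_unfold) (simp add: left_diff_distrib mult.assoc)
  qed
qed

text \<open>Writing \<open>s\<close> as \<open>s * omega s\<close> reduces to an idempotent, for
  which only the supports above its own contribute.\<close>

lemma H_mult_sum_all_e: "H s * (\<Sum>Y\<in>idems_T. e Y) = H s"
proof -
  have "H (omega s) * (\<Sum>Y\<in>idems_T. e Y) = H (omega s) * (\<Sum>Y | less_eq_T (supp (omega s)) Y. e Y)"
    using H_mult_e_eq_0[of _ "omega s"] less_eq_T_idems_T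
    by (intro sum_e_supported) auto
  then have "H (omega s) * (\<Sum>Y\<in>idems_T. e Y) = H (omega s)"
    using H_mult_sum_e[of "omega s"] by simp
  then have "H s * H (omega s) * (\<Sum>Y\<in>idems_T. e Y) = H s * H (omega s)"
    by (simp add: mult.assoc)
  then show ?thesis by (simp add: H_mult mult_omega)
qed

end

section \<open>Characters of the maximal subgroups\<close>

lemma carrier_maxgroup [simp]: "s \<in> carrier (maxgroup x) \<longleftrightarrow> omega s = x"
  by (simp add: maxgroup_def)

lemma finite_maxgroup: "finite (carrier (maxgroup x))" for x :: "'s::lrbg"
  by simp

lemma mult_maxgroup [simp]: "s \<otimes>\<^bsub>maxgroup x\<^esub> t = s * t"
  and one_maxgroup [simp]: "\<one>\<^bsub>maxgroup x\<^esub> = x"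
  by (simp_all add: maxgroup_def)

text \<open>Closure of the maximal subgroup: \<open>x\<close> is a left unit of the product, hence
  of its idempotent power, and it also absorbs that power.\<close>

lemma omega_mult_same:
  fixes s t :: "'s::lrbg"
  assumes s: "omega s = x" and t: "omega t = x"
  shows "omega (s * t) = x"
proof -
  have x: "x \<in> idems" using s by auto
  have "x * omega (s * t) = x"
    unfolding absorb_omega_mult[OF x] using s t x idems_mult_self by simp
  moreover have "omega (s * t) = x * omega (s * t)"
    using omega_idem_mult[OF x, of "s * t"] s by (metis mult.assoc omega_absorb)
  ultimately show ?thesis by simp
qed

lemma group_maxgroup:
  fixes x :: "'s::lrbg"
  assumes x: "x \<in> idems"
  shows "group (maxgroup x)"
proof -
  \<comment> \<open>A partner \<open>t\<close> with \<open>s * t = x\<close> need not lie in the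
    group at \<open>x\<close>, but \<open>x * t\<close> does.\<close>
  have right_inverse: "\<exists>t. omega t = x \<and> s * t = x" if s: "omega s = x" for s :: 's
  proof -
    obtain t where t: "s * t = x" using mult_omega_cancel[of s] s by auto
    have "s * (x * t) = x" using t s mult_omega[of s] by (simp add: mult.assoc[symmetric])
    moreover have "x * omega t = x"
      using absorb_omega_mult[OF x, of s t] t x by (simp add: idems_omega idems_mult_self)
    ultimately show ?thesis using omega_idem_mult[OF x, of t] by metis
  qed
  have right_one: "s * x = s" if "omega s = x" for s :: 's
    using mult_omega[of s] that by simp
  have left_one: "x * s = s" if "omega s = x" for s :: 's
    using omega_absorb[of s] that by simp
  show ?thesis
  proof (rule groupI)
    fix s assume "s \<in> carrier (maxgroup x)"
    then have s: "omega s = x" by simp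
    then obtain t where t: "omega t = x" "s * t = x" using right_inverse by blast
    then obtain r where r: "omega r = x" "t * r = x" using right_inverse by blast
    \<comment> \<open>The right inverse of a right inverse of \<open>s\<close> is \<open>s\<close>,
      so right inverses are two-sided.\<close>
    have "s = s * (t * r)" using r right_one s by simp
    also have "\<dots> = s * t * r" by (simp only: mult.assoc)
    also have "\<dots> = r" using t left_one[OF r(1)] by simp
    finally show "\<exists>t\<in>carrier (maxgroup x). t \<otimes>\<^bsub>maxgroup x\<^esub> s = \<one>\<^bsub>maxgroup x\<^esub>"
      using t r by auto
  qed (simp_all add: omega_mult_same left_one idems_omega[OF x] mult.assoc)
qed

lemma chars_iff:
  "(x, f) \<in> chars \<longleftrightarrow> x \<in> idems \<and> f \<in> hom (maxgroup x) cunits \<inter> extensional (carrier (maxgroup x))"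
  by (simp add: chars_def)

lemma chars_idems: "\<phi> \<in> chars \<Longrightarrow> fst \<phi> \<in> idems"
  by (auto simp: chars_def)

lemma chars_hom: "\<phi> \<in> chars \<Longrightarrow> snd \<phi> \<in> hom (maxgroup (fst \<phi>)) cunits"
  by (auto simp: chars_def)

lemma chars_mult:
  fixes \<phi> :: "'s::lrbg chr"
  assumes "\<phi> \<in> chars" "omega s = fst \<phi>" "omega t = fst \<phi>"
  shows "snd \<phi> (s * t) = snd \<phi> s * snd \<phi> t"
  using group.hom_cunits_mult[OF group_maxgroup[OF chars_idems] chars_hom] assms by fastforce

lemma chars_one: "\<phi> \<in> chars \<Longrightarrow> snd \<phi> (fst \<phi>) = 1" for \<phi> :: "'s::lrbg chr"
  using group.hom_cunits_one[OF group_maxgroup[OF chars_idems] chars_hom] by fastforce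

lemma chars_cnj: "\<phi> \<in> chars \<Longrightarrow> omega s = fst \<phi> \<Longrightarrow> cnj (snd \<phi> s) * snd \<phi> s = 1"
  for \<phi> :: "'s::lrbg chr"
  using group.hom_cunits_cnj[OF group_maxgroup[OF chars_idems] chars_hom _ finite_maxgroup]
  by fastforce

lemma finite_chars: "finite (chars :: 's::lrbg chr set)"
  unfolding chars_def
  by (intro finite_SigmaI group.finite_hom_cunits group_maxgroup finite_maxgroup) simp_all

lemma sim_chars_iff:
  fixes \<phi> \<psi> :: "'s::lrbg chr"
  shows "(\<phi>, \<psi>) \<in> sim_chars \<longleftrightarrow> \<phi> \<in> chars \<and> \<psi> \<in> chars \<and> supp (fst \<phi>) = supp (fst \<psi>)
    \<and> (\<forall>s. omega s = fst \<phi> \<longrightarrow> snd \<phi> s = snd \<psi> (fst \<psi> * s))"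
  by (auto simp: sim_chars_def lam_def supp_eq_iff)

lemma sim_chars_chars: "(\<phi>, \<psi>) \<in> sim_chars \<Longrightarrow> \<phi> \<in> chars" "(\<phi>, \<psi>) \<in> sim_chars \<Longrightarrow> \<psi> \<in> chars"
  by (simp_all add: sim_chars_def)

lemma sim_chars_supp: "(\<phi>, \<psi>) \<in> sim_chars \<Longrightarrow> supp (fst \<phi>) = supp (fst \<psi>)"
  for \<phi> :: "'s::lrbg chr"
  by (simp add: sim_chars_iff)

lemma sim_chars_absorb:
  fixes \<phi> :: "'s::lrbg chr"
  assumes "(\<phi>, \<psi>) \<in> sim_chars"
  shows "fst \<phi> * fst \<psi> = fst \<phi>" "fst \<psi> * fst \<phi> = fst \<psi>"
  using assms sim_chars_chars[OF assms] supp_idem_eq_iff[OF chars_idems chars_idems]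
  by (metis sim_chars_supp)+

lemma equiv_sim_chars: "equiv (chars :: 's::lrbg chr set) sim_chars"
proof (rule equivI)
  show "refl_on chars (sim_chars :: ('s chr \<times> _) set)"
    by (rule refl_onI) (auto simp: sim_chars_iff omega_absorb dest: sym)
  show "sym (sim_chars :: ('s chr \<times> _) set)"
  proof (rule symI)
    fix \<phi> \<psi> :: "'s chr" assume sim: "(\<phi>, \<psi>) \<in> sim_chars"
    let ?x = "fst \<phi>" let ?y = "fst \<psi>"
    have x: "?x \<in> idems" and xy: "?x * ?y = ?x" "?y * ?x = ?y"
      using sim sim_chars_absorb[OF sim] by (auto simp: sim_chars_iff chars_idems)
    have "snd \<psi> s = snd \<phi> (?x * s)" if s: "omega s = ?y" for s
    proof -
      \<comment> \<open>The preimage of \<open>s\<close> under left multiplication by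
        \<open>?y\<close> is \<open>?x * s\<close>.\<close>
      have "omega (?x * s) = ?x" using s xy by (simp add: omega_idem_mult[OF x])
      then have "snd \<phi> (?x * s) = snd \<psi> (?y * (?x * s))" using sim by (simp add: sim_chars_iff)
      also have "?y * (?x * s) = s" using xy omega_absorb[of s] s by (simp add: mult.assoc[symmetric])
      finally show ?thesis by simp
    qed
    then show "(\<psi>, \<phi>) \<in> sim_chars" using sim by (auto simp: sim_chars_iff)
  qed
  show "trans (sim_chars :: ('s chr \<times> _) set)"
  proof (rule transI)
    fix \<phi> \<psi> \<theta> :: "'s chr" assume sim: "(\<phi>, \<psi>) \<in> sim_chars" "(\<psi>, \<theta>) \<in> sim_chars"
    let ?x = "fst \<phi>" let ?y = "fst \<psi>" let ?z = "fst \<theta>"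
    have y: "?y \<in> idems" using sim by (simp add: sim_chars_iff chars_idems)
    have xy: "?y * ?x = ?y" and yz: "?z * ?y = ?z" using sim sim_chars_absorb by blast+
    have "snd \<phi> s = snd \<theta> (?z * s)" if s: "omega s = ?x" for s
    proof -
      have "omega (?y * s) = ?y" using s xy by (simp add: omega_idem_mult[OF y])
      then have "snd \<psi> (?y * s) = snd \<theta> (?z * (?y * s))" using sim by (simp add: sim_chars_iff)
      then show ?thesis using sim s yz by (simp add: sim_chars_iff mult.assoc[symmetric])
    qed
    then show "(\<phi>, \<theta>) \<in> sim_chars" using sim by (auto simp: sim_chars_iff)
  qed
qed (auto simp: sim_chars_def)

lemma sim_chars_refl: "\<phi> \<in> chars \<Longrightarrow> (\<phi>, \<phi>) \<in> sim_chars" for \<phi> :: "'s::lrbg chr"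
  using equiv_sim_chars by (meson equivE refl_onD)

lemma sim_chars_sym: "(\<phi>, \<psi>) \<in> sim_chars \<Longrightarrow> (\<psi>, \<phi>) \<in> sim_chars" for \<phi> :: "'s::lrbg chr"
  using equiv_sim_chars by (meson equivE symE)

lemma sim_chars_trans:
  "(\<phi>, \<psi>) \<in> sim_chars \<Longrightarrow> (\<psi>, \<theta>) \<in> sim_chars \<Longrightarrow> (\<phi>, \<theta>) \<in> sim_chars" for \<phi> :: "'s::lrbg chr"
  using equiv_sim_chars by (meson equivE transE)

lemma sim_chars_exists:
  fixes \<phi> :: "'s::lrbg chr"
  assumes \<phi>: "\<phi> \<in> chars" and y: "y \<in> idems" "supp y = supp (fst \<phi>)"
  shows "\<exists>\<psi>. (\<phi>, \<psi>) \<in> sim_chars \<and> fst \<psi> = y"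
proof -
  let ?x = "fst \<phi>"
  have x: "?x \<in> idems" using \<phi> by (rule chars_idems)
  have xy: "?x * y = ?x" "y * ?x = y" using y x supp_idem_eq_iff by metis+
  \<comment> \<open>Left multiplication by \<open>?x\<close> is the inverse of
    \<open>lam y ?x\<close>, so this transports the character to the group at
    \<open>y\<close>.\<close>
  define g where "g = (\<lambda>s\<in>carrier (maxgroup y). snd \<phi> (?x * s))"
  have omega: "omega (?x * s) = ?x" if "omega s = y" for s
    using that xy by (simp add: omega_idem_mult[OF x])
  have "g \<in> hom (maxgroup y) cunits"
  proof (rule homI)
    fix s assume "s \<in> carrier (maxgroup y)"
    then have "snd \<phi> (?x * s) \<in> carrier cunits"
      using hom_in_carrier[OF chars_hom[OF \<phi>], of "?x * s"] omega by simp
    then show "g s \<in> carrier cunits" using \<open>s \<in> _\<close> by (simp add: g_def)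
  next
    fix s t assume st: "s \<in> carrier (maxgroup y)" "t \<in> carrier (maxgroup y)"
    have "?x * (s * t) = ?x * s * (?x * t)"
      using idem_regular[OF x, of s] by (simp add: mult.assoc[symmetric])
    then show "g (s \<otimes>\<^bsub>maxgroup y\<^esub> t) = g s \<otimes>\<^bsub>cunits\<^esub> g t"
      using st chars_mult[OF \<phi> omega omega, of s t]
      by (simp add: g_def omega_mult_same cunits_def)
  qed
  then have "(y, g) \<in> chars" using y by (simp add: chars_iff g_def)
  moreover have "snd \<phi> s = g (y * s)" if "omega s = ?x" for s
  proof -
    have "?x * (y * s) = s" using xy that omega_absorb[of s] by (simp add: mult.assoc[symmetric])
    then show ?thesis using that xy by (simp add: g_def omega_idem_mult[OF y(1)])
  qed
  ultimately have "(\<phi>, (y, g)) \<in> sim_chars" using \<phi> y by (simp add: sim_chars_iff)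
  then show ?thesis by (intro exI[of _ "(y, g)"]) simp
qed

text \<open>Between equal idempotents \<open>lam\<close> is the identity. Together with
  \<open>sim_chars_exists\<close>, a class has exactly one member at each idempotent of its
  support.\<close>

lemma sim_chars_same_fst:
  fixes \<phi> :: "'s::lrbg chr"
  assumes "(\<phi>, \<psi>) \<in> sim_chars" "fst \<phi> = fst \<psi>"
  shows "\<phi> = \<psi>"
proof -
  have "\<phi> \<in> chars" "\<psi> \<in> chars" using assms sim_chars_chars by blast+
  moreover have "snd \<phi> s = snd \<psi> s" if "omega s = fst \<phi>" for s
    using assms that omega_absorb[of s] by (simp add: sim_chars_iff)
  ultimately show ?thesis
    using assms(2) by (auto simp: chars_def intro: extensionalityI)
qed

section \<open>The multiplicative functionals\<close>

text \<open>The functionals \<open>chi \<phi>\<close> are the characters of the semisimple quotient of the algebra.\<close>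

definition chi_basis :: "'s::{semigroup_mult, finite} chr \<Rightarrow> 's \<Rightarrow> complex" where
  "chi_basis \<phi> s = (if fst \<phi> * omega s = fst \<phi> then snd \<phi> (fst \<phi> * s) else 0)"

definition chi :: "'s::{semigroup_mult, finite} chr \<Rightarrow> 's semigroup_algebra \<Rightarrow> complex" where
  "chi \<phi> a = (\<Sum>s\<in>UNIV. coeff a s * chi_basis \<phi> s)"

lemma chi_H: "chi \<phi> (H s) = chi_basis \<phi> s"
  by (simp add: chi_def coeff_H if_distrib[of "\<lambda>z. z * _"] sum.delta cong: if_cong)

lemma chi_zero: "chi \<phi> 0 = 0"
  and chi_add: "chi \<phi> (a + b) = chi \<phi> a + chi \<phi> b"
  and chi_diff: "chi \<phi> (a - b) = chi \<phi> a - chi \<phi> b"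
  and chi_scale: "chi \<phi> (scale c a) = c * chi \<phi> a"
  by (simp_all add: chi_def coeff_simps sum.distrib sum_subtractf algebra_simps sum_distrib_left)

lemma chi_sum: "chi \<phi> (\<Sum>i\<in>I. a i) = (\<Sum>i\<in>I. chi \<phi> (a i))"
  by (induction I rule: infinite_finite_induct) (simp_all add: chi_zero chi_add)

text \<open>The two cases fit together: the idempotent at \<open>\<phi>\<close> absorbs
  \<open>omega (s * t)\<close> exactly when it absorbs both \<open>omega s\<close> and
  \<open>omega t\<close>, and then multiplication into the group is a homomorphism.\<close>

lemma chi_basis_mult:
  fixes \<phi> :: "'s::lrbg chr"
  assumes \<phi>: "\<phi> \<in> chars"
  shows "chi_basis \<phi> (s * t) = chi_basis \<phi> s * chi_basis \<phi> t"
proof -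
  let ?y = "fst \<phi>"
  have y: "?y \<in> idems" using \<phi> by (rule chars_idems)
  have "?y * (s * t) = ?y * s * (?y * t)"
    using idem_regular[OF y, of s] by (simp add: mult.assoc[symmetric])
  then show ?thesis
    using chars_mult[OF \<phi>, of "?y * s" "?y * t"]
    by (auto simp: chi_basis_def absorb_omega_mult[OF y] omega_idem_mult[OF y])
qed

lemma chi_mult:
  fixes \<phi> :: "'s::lrbg chr"
  assumes \<phi>: "\<phi> \<in> chars"
  shows "chi \<phi> (a * b) = chi \<phi> a * chi \<phi> b"
proof -
  have "chi \<phi> (H s * b) = chi_basis \<phi> s * chi \<phi> b" for s
    unfolding mult_expand_right[of "H s" b]
    by (simp add: chi_sum chi_scale H_mult chi_H chi_basis_mult[OF \<phi>])
      (simp add: chi_def sum_distrib_left mult_ac)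
  then show ?thesis
    unfolding mult_expand_left[of a b]
    by (simp add: chi_sum chi_scale) (simp add: chi_def[of \<phi> a] sum_distrib_right mult.assoc)
qed

text \<open>On the group algebra at its own idempotent the functional is the usual pairing with the
  character.\<close>

lemma chi_maxgroup:
  fixes \<phi> :: "'s::lrbg chr"
  assumes \<phi>: "\<phi> \<in> chars" and a: "\<And>s. coeff a s \<noteq> 0 \<Longrightarrow> omega s = fst \<phi>"
  shows "chi \<phi> a = (\<Sum>s\<in>carrier (maxgroup (fst \<phi>)). coeff a s * snd \<phi> s)"
proof -
  have "chi \<phi> a = (\<Sum>s\<in>carrier (maxgroup (fst \<phi>)). coeff a s * chi_basis \<phi> s)"
    unfolding chi_def
  proof (intro sum.mono_neutral_right ballI)
    fix s assume "s \<in> UNIV - carrier (maxgroup (fst \<phi>))"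
    then have "coeff a s = 0" using a[of s] by auto
    then show "coeff a s * chi_basis \<phi> s = 0" by simp
  qed simp_all
  also have "\<dots> = (\<Sum>s\<in>carrier (maxgroup (fst \<phi>)). coeff a s * snd \<phi> s)"
  proof (intro sum.cong refl)
    fix s assume "s \<in> carrier (maxgroup (fst \<phi>))"
    then have "chi_basis \<phi> s = snd \<phi> s"
      using omega_absorb[of s] chars_idems[OF \<phi>] by (simp add: chi_basis_def idems_mult_self)
    then show "coeff a s * chi_basis \<phi> s = coeff a s * snd \<phi> s" by simp
  qed
  finally show ?thesis .
qed

lemma chi_sim:
  fixes \<phi> :: "'s::lrbg chr"
  assumes sim: "(\<phi>, \<psi>) \<in> sim_chars"
  shows "chi \<phi> = chi \<psi>"
proof -
  let ?x = "fst \<phi>" let ?y = "fst \<psi>"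
  have x: "?x \<in> idems" and xy: "?x * ?y = ?x" "?y * ?x = ?y"
    using sim sim_chars_absorb[OF sim] by (auto simp: sim_chars_iff chars_idems)
  have "chi_basis \<phi> s = chi_basis \<psi> s" for s
  proof -
    have iff: "?x * omega s = ?x \<longleftrightarrow> ?y * omega s = ?y" using xy by (metis mult.assoc)
    show ?thesis
    proof (cases "?x * omega s = ?x")
      case True
      then have "omega (?x * s) = ?x" by (simp add: omega_idem_mult[OF x])
      then have "snd \<phi> (?x * s) = snd \<psi> (?y * (?x * s))" using sim by (simp add: sim_chars_iff)
      then show ?thesis using True iff xy by (simp add: chi_basis_def mult.assoc[symmetric])
    qed (simp add: chi_basis_def iff)
  qed
  then show ?thesis by (simp add: chi_def fun_eq_iff)
qed

section \<open>The idempotents of the maximal subgroups\<close>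

lemma coeff_E_chr:
  "coeff (E_chr \<phi>) s = (if omega s = fst \<phi>
    then cnj (snd \<phi> s) / of_nat (card (carrier (maxgroup (fst \<phi>)))) else 0)"
  for \<phi> :: "'s::lrbg chr"
proof -
  have "coeff (E_chr \<phi>) s = 1 / of_nat (card (carrier (maxgroup (fst \<phi>)))) *
      (\<Sum>t\<in>carrier (maxgroup (fst \<phi>)). if t = s then cnj (snd \<phi> t) else 0)"
    unfolding E_chr_def coeff_scale coeff_sum
    by (intro arg_cong2[where f = "(*)"] refl sum.cong) (auto simp: coeff_H)
  then show ?thesis by (simp add: sum.delta)
qed

lemma card_maxgroup: "x \<in> idems \<Longrightarrow> card (carrier (maxgroup x)) > 0" for x :: "'s::lrbg"
  using idems_omega[of x] finite_maxgroup by (auto simp: card_gt_0_iff)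

lemma E_chr_mult_H: "E_chr \<phi> * H (fst \<phi>) = E_chr \<phi>" for \<phi> :: "'s::lrbg chr"
  by (rule mult_eq_left_supported)
    (auto simp: coeff_E_chr H_mult mult_omega split: if_splits dest!: sym[of _ "fst \<phi>"])

text \<open>Substitute \<open>t * s\<close> for the summation variable; \<open>snd \<phi> t\<close>
  has absolute value 1, so its conjugate is its inverse.\<close>

lemma H_mult_E_chr:
  fixes \<phi> :: "'s::lrbg chr"
  assumes \<phi>: "\<phi> \<in> chars" and t: "omega t = fst \<phi>"
  shows "H t * E_chr \<phi> = scale (snd \<phi> t) (E_chr \<phi>)"
proof -
  let ?x = "fst \<phi>" and ?f = "snd \<phi>"
  let ?G = "carrier (maxgroup ?x)"
  interpret group "maxgroup ?x" by (rule group_maxgroup[OF chars_idems[OF \<phi>]])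
  have "(\<Sum>s\<in>?G. scale (?f t * cnj (?f s)) (H s))
      = (\<Sum>s\<in>?G. scale (?f t * cnj (?f (t * s))) (H (t * s)))"
    using sum.reindex_bij_betw[OF translate_bij[of t],
        of "\<lambda>s. scale (?f t * cnj (?f s)) (H s)"] t by simp
  also have "\<dots> = (\<Sum>s\<in>?G. scale (cnj (?f s)) (H (t * s)))"
  proof (intro sum.cong refl)
    fix s assume "s \<in> ?G"
    then have "?f t * cnj (?f (t * s)) = cnj (?f t) * ?f t * cnj (?f s)"
      using chars_mult[OF \<phi> t, of s] by simp
    then show "scale (?f t * cnj (?f (t * s))) (H (t * s)) = scale (cnj (?f s)) (H (t * s))"
      using chars_cnj[OF \<phi> t] by simp
  qed
  finally have eq: "(\<Sum>s\<in>?G. scale (?f t * cnj (?f s)) (H s)) = (\<Sum>s\<in>?G. scale (cnj (?f s)) (H (t * s)))" .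
  have "H t * E_chr \<phi> = scale (1 / of_nat (card ?G)) (\<Sum>s\<in>?G. scale (cnj (?f s)) (H (t * s)))"
    by (simp add: E_chr_def scale_mult_right sum_distrib_left H_mult)
  also have "\<dots> = scale (?f t) (E_chr \<phi>)"
    unfolding eq[symmetric] E_chr_def by (simp add: scale_scale scale_sum_right mult_ac)
  finally show ?thesis .
qed

text \<open>Left multiplication by the second idempotent is a bijection of the two groups that
  carries one character to the other.\<close>

lemma H_mult_E_chr_sim:
  fixes \<phi> :: "'s::lrbg chr"
  assumes sim: "(\<phi>, \<psi>) \<in> sim_chars"
  shows "H (fst \<psi>) * E_chr \<phi> = E_chr \<psi>"
proof -
  let ?x = "fst \<phi>" let ?y = "fst \<psi>"
  have x: "?x \<in> idems" and y: "?y \<in> idems" and xy: "?x * ?y = ?x" "?y * ?x = ?y"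
    using sim sim_chars_absorb[OF sim] by (auto simp: sim_chars_iff chars_idems)
  have absorb: "s * (t * r) = s * r" if "s * t = s" for s t r :: 's
    using that by (simp add: mult.assoc[symmetric])
  have cancel: "?x * s = s" if "omega s = ?x" for s using omega_absorb[of s] that by simp
  have cancel': "?y * s = s" if "omega s = ?y" for s using omega_absorb[of s] that by simp
  have bij: "bij_betw (\<lambda>s. ?y * s) (carrier (maxgroup ?x)) (carrier (maxgroup ?y))"
    by (rule bij_betw_byWitness[where f' = "\<lambda>s. ?x * s"])
      (auto simp: absorb xy cancel cancel' omega_idem_mult x y)
  have "H ?y * E_chr \<phi> = scale (1 / of_nat (card (carrier (maxgroup ?x))))
      (\<Sum>s\<in>carrier (maxgroup ?x). scale (cnj (snd \<phi> s)) (H (?y * s)))"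
    by (simp add: E_chr_def scale_mult_right sum_distrib_left H_mult)
  also have "(\<Sum>s\<in>carrier (maxgroup ?x). scale (cnj (snd \<phi> s)) (H (?y * s)))
      = (\<Sum>s\<in>carrier (maxgroup ?x). scale (cnj (snd \<psi> (?y * s))) (H (?y * s)))"
    using sim by (intro sum.cong refl) (simp add: sim_chars_iff)
  also have "\<dots> = (\<Sum>s\<in>carrier (maxgroup ?y). scale (cnj (snd \<psi> s)) (H s))"
    by (rule sum.reindex_bij_betw[OF bij])
  finally show ?thesis by (simp add: E_chr_def bij_betw_same_card[OF bij])
qed

lemma sum_E_chr_character:
  fixes \<phi> \<psi> :: "'s::lrbg chr"
  assumes "\<phi> \<in> chars" "\<psi> \<in> chars" "fst \<phi> = fst \<psi>"
  shows "(\<Sum>s\<in>carrier (maxgroup (fst \<phi>)). coeff (E_chr \<phi>) s * snd \<psi> s) = (if \<phi> = \<psi> then 1 else 0)"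
proof -
  let ?G = "carrier (maxgroup (fst \<phi>))"
  have x: "fst \<phi> \<in> idems" using assms(1) by (rule chars_idems)
  have "(\<Sum>s\<in>?G. coeff (E_chr \<phi>) s * snd \<psi> s) = (\<Sum>s\<in>?G. cnj (snd \<phi> s) * snd \<psi> s) / of_nat (card ?G)"
    unfolding sum_divide_distrib by (intro sum.cong refl) (simp add: coeff_E_chr)
  also have "(\<Sum>s\<in>?G. cnj (snd \<phi> s) * snd \<psi> s) = (if snd \<psi> = snd \<phi> then of_nat (card ?G) else 0)"
    using assms by (intro group.character_orthogonality[OF group_maxgroup[OF x] _ _ finite_maxgroup])
      (auto simp: chars_def)
  finally show ?thesis using assms(3) card_maxgroup[OF x] by (auto simp: prod_eq_iff)
qed

lemma E_chr_mult_E_chr: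
  fixes \<phi> \<psi> :: "'s::lrbg chr"
  assumes "\<phi> \<in> chars" "\<psi> \<in> chars" "fst \<phi> = fst \<psi>"
  shows "E_chr \<phi> * E_chr \<psi> = (if \<phi> = \<psi> then E_chr \<phi> else 0)"
proof -
  have "E_chr \<phi> * E_chr \<psi> = (\<Sum>s\<in>UNIV. scale (coeff (E_chr \<phi>) s) (H s * E_chr \<psi>))"
    by (rule mult_expand_left)
  also have "\<dots> = (\<Sum>s\<in>carrier (maxgroup (fst \<phi>)). scale (coeff (E_chr \<phi>) s) (H s * E_chr \<psi>))"
    by (rule sum.mono_neutral_right) (auto simp: coeff_E_chr scale_zero_left)
  also have "\<dots> = (\<Sum>s\<in>carrier (maxgroup (fst \<phi>)). scale (coeff (E_chr \<phi>) s * snd \<psi> s) (E_chr \<psi>))"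
    using assms by (intro sum.cong refl) (simp add: H_mult_E_chr scale_scale)
  also have "\<dots> = scale (if \<phi> = \<psi> then 1 else 0) (E_chr \<psi>)"
    using sum_E_chr_character[OF assms] by (simp add: scale_sum_left[symmetric])
  finally show ?thesis by (simp add: scale_zero_left scale_one)
qed

text \<open>Within its class, \<open>\<psi>\<close> can be moved to the idempotent of
  \<open>\<phi>\<close>, where orthogonality of characters of a single group applies.\<close>

lemma chi_E_chr:
  fixes \<phi> \<psi> :: "'s::lrbg chr"
  assumes \<phi>: "\<phi> \<in> chars" and \<psi>: "\<psi> \<in> chars" and supp: "supp (fst \<phi>) = supp (fst \<psi>)"
  shows "chi \<psi> (E_chr \<phi>) = (if (\<phi>, \<psi>) \<in> sim_chars then 1 else 0)"
proof -
  obtain \<theta> where \<theta>: "(\<psi>, \<theta>) \<in> sim_chars" "fst \<theta> = fst \<phi>"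
    using sim_chars_exists[OF \<psi> chars_idems[OF \<phi>] supp] by blast
  have "chi \<psi> (E_chr \<phi>) = chi \<theta> (E_chr \<phi>)" using chi_sim[OF \<theta>(1)] by simp
  also have "\<dots> = (if \<phi> = \<theta> then 1 else 0)"
    using sum_E_chr_character[OF \<phi> _ \<theta>(2)[symmetric]] sim_chars_chars[OF \<theta>(1)] \<theta>(2)
    by (subst chi_maxgroup) (auto simp: coeff_E_chr split: if_splits)
  also have "\<phi> = \<theta> \<longleftrightarrow> (\<phi>, \<psi>) \<in> sim_chars"
    using \<theta> sim_chars_sym sim_chars_trans sim_chars_same_fst by metis
  finally show ?thesis .
qed

text \<open>The difference of the two sides lies in the group algebra at \<open>x\<close> and pairs
  to zero with every character, so it vanishes by separation of points; no count of the characters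
  is required.\<close>

lemma sum_E_chr:
  fixes x :: "'s::lrbg"
  assumes "comm_group (maxgroup x)" and x: "x \<in> idems"
  shows "(\<Sum>\<phi> | \<phi> \<in> chars \<and> fst \<phi> = x. E_chr \<phi>) = H x"
proof -
  interpret comm_group "maxgroup x" by fact
  let ?a = "(\<Sum>\<phi> | \<phi> \<in> chars \<and> fst \<phi> = x. E_chr \<phi>) - H x"
  have supported: "omega s = x" if "coeff ?a s \<noteq> 0" for s
  proof (rule ccontr)
    assume "omega s \<noteq> x"
    then show False using that idems_omega[OF x] by (auto simp: coeff_simps coeff_E_chr split: if_splits)
  qed
  have "coeff ?a s = 0" if s: "omega s = x" for s
  proof (rule characters_separate[OF finite_maxgroup])
    fix f assume "f \<in> hom (maxgroup x) cunits \<inter> extensional (carrier (maxgroup x))"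
    then have \<psi>: "(x, f) \<in> chars" using x by (simp add: chars_iff)
    have "chi (x, f) ?a = (\<Sum>\<phi> | \<phi> \<in> chars \<and> fst \<phi> = x. if \<phi> = (x, f) then 1 else 0) - 1"
    proof -
      have "chi (x, f) (E_chr \<phi>) = (if \<phi> = (x, f) then 1 else 0)"
        if "\<phi> \<in> chars \<and> fst \<phi> = x" for \<phi>
        using chi_E_chr[of \<phi> "(x, f)"] sim_chars_same_fst[of \<phi> "(x, f)"] sim_chars_refl[OF \<psi>] that \<psi>
        by auto
      then have "(\<Sum>\<phi> | \<phi> \<in> chars \<and> fst \<phi> = x. chi (x, f) (E_chr \<phi>))
          = (\<Sum>\<phi> | \<phi> \<in> chars \<and> fst \<phi> = x. if \<phi> = (x, f) then 1 else 0)"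
        by (intro sum.cong refl) blast
      moreover have "chi_basis (x, f) x = 1"
        using chars_one[OF \<psi>] x by (simp add: chi_basis_def idems_omega idems_mult_self)
      ultimately show ?thesis by (simp add: chi_diff chi_sum chi_H)
    qed
    also have "\<dots> = 0" using \<psi> by (simp add: sum.delta finite_chars)
    finally show "(\<Sum>g\<in>carrier (maxgroup x). coeff ?a g * f g) = 0"
      using chi_maxgroup[OF \<psi>, of ?a] supported by simp
  qed (use s in simp)
  then have zero: "coeff ?a s = 0" for s using supported by blast
  have "?a = 0" by (rule semigroup_algebra_eqI) (simp only: zero coeff_zero)
  then show ?thesis by simp
qed

section \<open>The idempotents of the character classes\<close>

context homogeneous
begin

text \<open>The section absorbs the idempotent that moves \<open>E_chr\<close> within its class.
  This is what makes \<open>e_class\<close> independent of the representative.\<close>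

lemma u_mult_E_chr_sim:
  assumes "(\<phi>, \<psi>) \<in> sim_chars"
  shows "u (supp (fst \<psi>)) * E_chr \<psi> = u (supp (fst \<phi>)) * E_chr \<phi>"
proof -
  have "fst \<psi> \<in> idems" using assms by (simp add: sim_chars_iff chars_idems)
  then have "u (supp (fst \<psi>)) * (H (fst \<psi>) * E_chr \<phi>) = u (supp (fst \<psi>)) * E_chr \<phi>"
    by (simp add: mult.assoc[symmetric] u_mult_H)
  then show ?thesis
    by (simp add: H_mult_E_chr_sim[OF assms] sim_chars_supp[OF assms])
qed

lemma e_class_eq:
  assumes \<phi>: "\<phi> \<in> chars"
  shows "e_class u (sim_chars `` {\<phi>}) = u (supp (fst \<phi>)) * (E_chr \<phi> * e (supp (fst \<phi>)))"
proof -
  define \<psi> where "\<psi> = (SOME \<psi>. \<psi> \<in> sim_chars `` {\<phi>})"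
  have "\<psi> \<in> sim_chars `` {\<phi>}"
    unfolding \<psi>_def by (rule someI[of _ \<phi>]) (simp add: sim_chars_refl[OF \<phi>])
  then have sim: "(\<phi>, \<psi>) \<in> sim_chars" by simp
  have "e_class u (sim_chars `` {\<phi>}) = u (supp (fst \<psi>)) * (E_chr \<psi> * H (fst \<psi>) * e (supp (fst \<psi>)))"
    unfolding e_class_def Let_def \<psi>_def[symmetric] Q_chr_def Q_circ_def
    by (simp add: mult.assoc)
  also have "\<dots> = u (supp (fst \<psi>)) * E_chr \<psi> * e (supp (fst \<psi>))"
    by (simp add: E_chr_mult_H mult.assoc)
  also have "\<dots> = u (supp (fst \<phi>)) * E_chr \<phi> * e (supp (fst \<phi>))"
    by (simp add: u_mult_E_chr_sim[OF sim] sim_chars_supp[OF sim])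
  finally show ?thesis by (simp add: mult.assoc)
qed

lemma E_chr_mult_u:
  assumes \<phi>: "\<phi> \<in> chars"
  shows "E_chr \<phi> * u (supp (fst \<phi>)) = E_chr \<phi>"
proof -
  have "E_chr \<phi> * (H (fst \<phi>) * u (supp (fst \<phi>))) = E_chr \<phi>"
    by (simp add: H_mult_u chars_idems[OF \<phi>] E_chr_mult_H)
  then show ?thesis by (simp add: mult.assoc[symmetric] E_chr_mult_H)
qed

lemma e_class_mult:
  assumes \<phi>: "\<phi> \<in> chars" and \<psi>: "\<psi> \<in> chars"
  shows "e_class u (sim_chars `` {\<phi>}) * e_class u (sim_chars `` {\<psi>})
    = (if (\<phi>, \<psi>) \<in> sim_chars then e_class u (sim_chars `` {\<phi>}) else 0)"
proof -
  let ?X = "supp (fst \<phi>)" and ?Y = "supp (fst \<psi>)"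
  have X: "?X \<in> idems_T" and Y: "?Y \<in> idems_T"
    using \<phi> \<psi> by (simp_all add: supp_in_idems_T chars_idems)
  have uu: "u ?Y * (u ?Y * E_chr \<psi>) = u ?Y * E_chr \<psi>"
    by (simp add: mult.assoc[symmetric] u_mult_u[OF Y])
  have "e_class u (sim_chars `` {\<phi>}) * e_class u (sim_chars `` {\<psi>})
      = u ?X * E_chr \<phi> * (e ?X * (u ?Y * E_chr \<psi> * e ?Y))"
    by (simp add: e_class_eq \<phi> \<psi> mult.assoc)
  also have "\<dots> = (if (\<phi>, \<psi>) \<in> sim_chars then e_class u (sim_chars `` {\<phi>}) else 0)"
  proof (cases "?X = ?Y")
    case False
    then have "(\<phi>, \<psi>) \<notin> sim_chars" using sim_chars_supp by blast
    then show ?thesis using e_mult_mult_e_distinct[OF X Y False uu] by simp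
  next
    case True
    \<comment> \<open>Moving \<open>\<psi>\<close> to the idempotent of \<open>\<phi>\<close> puts
      both characters on one group; the inner \<open>e ?X\<close> then disappears and a product of
      two \<open>E_chr\<close> elements remains.\<close>
    obtain \<theta> where \<theta>: "(\<psi>, \<theta>) \<in> sim_chars" "fst \<theta> = fst \<phi>"
      using sim_chars_exists[OF \<psi> chars_idems[OF \<phi>] True] by blast
    have \<theta>': "\<theta> \<in> chars" using \<theta> sim_chars_chars by blast
    have u\<theta>: "u ?Y * E_chr \<psi> = u ?X * E_chr \<theta>"
      using u_mult_E_chr_sim[OF \<theta>(1)] \<theta>(2) by simp
    have "u ?X * E_chr \<phi> * (e ?X * (u ?Y * E_chr \<psi> * e ?Y))
        = u ?X * E_chr \<phi> * (u ?X * E_chr \<theta> * e ?X)"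
      using e_mult_mult_e_same[OF Y uu] True u\<theta> by simp
    also have "\<dots> = u ?X * ((E_chr \<phi> * u ?X) * (E_chr \<theta> * e ?X))" by (simp add: mult.assoc)
    also have "\<dots> = u ?X * ((E_chr \<phi> * E_chr \<theta>) * e ?X)"
      by (simp add: E_chr_mult_u[OF \<phi>] mult.assoc)
    also have "\<dots> = (if \<phi> = \<theta> then e_class u (sim_chars `` {\<phi>}) else 0)"
      using E_chr_mult_E_chr[OF \<phi> \<theta>' \<theta>(2)[symmetric]] by (simp add: e_class_eq[OF \<theta>'])
    also have "\<phi> = \<theta> \<longleftrightarrow> (\<phi>, \<psi>) \<in> sim_chars"
      using \<theta> sim_chars_sym sim_chars_trans sim_chars_same_fst by metis
    finally show ?thesis .
  qed
  finally show ?thesis .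
qed

text \<open>All idempotents in \<open>u X\<close> have the same value, 0 or 1, under the functional,
  and their coefficients sum to one.\<close>

lemma chi_u:
  assumes X: "X \<in> idems_T" and \<phi>: "\<phi> \<in> chars"
  shows "chi \<phi> (u X) = (if less_eq_T X (supp (fst \<phi>)) then 1 else 0)"
proof -
  let ?c = "if less_eq_T X (supp (fst \<phi>)) then 1 else 0 :: complex"
  have "coeff (u X) s * chi_basis \<phi> s = coeff (u X) s * ?c" for s
  proof (cases "coeff (u X) s = 0")
    case False
    then have s: "s \<in> idems" "supp s = X" using coeff_u(1)[OF X] by auto
    then have "chi_basis \<phi> s = ?c"
      using less_eq_T_supp[OF s(1) chars_idems[OF \<phi>]] chars_one[OF \<phi>]
      by (simp add: chi_basis_def idems_omega)
    then show ?thesis by simp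
  qed simp
  then have "chi \<phi> (u X) = (\<Sum>s\<in>UNIV. coeff (u X) s) * ?c"
    unfolding chi_def sum_distrib_right by (intro sum.cong refl)
  then show ?thesis by (simp add: coeff_u(2)[OF X])
qed

text \<open>Under the functional the recursion becomes numerical: below
  \<open>supp (fst \<phi>)\<close> the single correction term 1 cancels the value 1 of
  \<open>u X\<close>, and only equality of supports escapes this.\<close>

lemma chi_e:
  assumes "X \<in> idems_T" and \<phi>: "\<phi> \<in> chars"
  shows "chi \<phi> (e X) = (if X = supp (fst \<phi>) then 1 else 0)"
  using assms(1)
proof (induction X rule: less_T_induct)
  case (step X)
  have "chi \<phi> (e Z) = (if Z = supp (fst \<phi>) then 1 else 0)" if XZ: "less_T X Z" for Z
    using step.IH[OF XZ] .
  then have "(\<Sum>Z | less_T X Z. chi \<phi> (e Z)) = (\<Sum>Z | less_T X Z. if Z = supp (fst \<phi>) then 1 else 0)"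
    by (intro sum.cong refl) blast
  also have "\<dots> = (if less_T X (supp (fst \<phi>)) then 1 else 0)" by simp
  finally have "chi \<phi> (e X) = chi \<phi> (u X) * (1 - (if less_T X (supp (fst \<phi>)) then 1 else 0))"
    by (subst e_unfold) (simp add: chi_diff chi_mult[OF \<phi>] chi_sum right_diff_distrib)
  then show ?case
    using step.hyps less_eq_T_refl[OF step.hyps] by (auto simp: chi_u[OF step.hyps \<phi>] less_T_def)
qed

lemma chi_e_class:
  assumes \<phi>: "\<phi> \<in> chars" and \<psi>: "\<psi> \<in> chars"
  shows "chi \<psi> (e_class u (sim_chars `` {\<phi>})) = (if (\<phi>, \<psi>) \<in> sim_chars then 1 else 0)"
proof -
  have X: "supp (fst \<phi>) \<in> idems_T" using \<phi> by (simp add: supp_in_idems_T chars_idems)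
  have chi: "chi \<psi> (e_class u (sim_chars `` {\<phi>}))
      = (if less_eq_T (supp (fst \<phi>)) (supp (fst \<psi>)) then 1 else 0)
        * (chi \<psi> (E_chr \<phi>) * (if supp (fst \<phi>) = supp (fst \<psi>) then 1 else 0))"
    by (simp only: e_class_eq[OF \<phi>] chi_mult[OF \<psi>] chi_u[OF X \<psi>] chi_e[OF X \<psi>])
  show ?thesis
  proof (cases "supp (fst \<phi>) = supp (fst \<psi>)")
    case True
    then show ?thesis using less_eq_T_refl[OF X] chi_E_chr[OF \<phi> \<psi> True] chi by simp
  next
    case False
    then show ?thesis using sim_chars_supp[of \<phi> \<psi>] chi by auto
  qed
qed

lemma sum_e_class:
  assumes abelian: "\<And>x::'s. x \<in> idems \<Longrightarrow> comm_group (maxgroup x)"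
  shows "(\<Sum>\<Phi>\<in>chars_T. e_class u \<Phi>) = (\<Sum>X\<in>idems_T. e X)"
proof -
  \<comment> \<open>One idempotent per support: the characters at these idempotents represent each
    class once, and their \<open>E_chr\<close> sum to \<open>H (rep X)\<close>, which
    \<open>u X\<close> absorbs.\<close>
  define rep where "rep X = (SOME x. x \<in> idems \<and> supp x = X)" for X :: "'s set"
  have rep: "rep X \<in> idems \<and> supp (rep X) = X" if "X \<in> idems_T" for X
  proof -
    have "\<exists>x. x \<in> idems \<and> supp x = X" using idems_T_cases[OF that] by metis
    then show ?thesis unfolding rep_def by (rule someI_ex)
  qed
  let ?F = "\<lambda>X. {\<phi> \<in> chars. fst \<phi> = rep X}"
  let ?R = "\<Union>X\<in>idems_T. ?F X"
  have fst_R: "fst \<phi> = rep (supp (fst \<phi>))" "\<phi> \<in> chars" if "\<phi> \<in> ?R" for \<phi>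
    using that by (auto simp: rep)
  have "bij_betw (\<lambda>\<phi>. sim_chars `` {\<phi>}) ?R chars_T"
    unfolding bij_betw_def
  proof
    show "inj_on (\<lambda>\<phi>. sim_chars `` {\<phi>}) ?R"
    proof (rule inj_onI)
      fix \<phi> \<psi> assume R: "\<phi> \<in> ?R" "\<psi> \<in> ?R" and "sim_chars `` {\<phi>} = sim_chars `` {\<psi>}"
      then have sim: "(\<phi>, \<psi>) \<in> sim_chars"
        using fst_R(2) sim_chars_refl by blast
      have "fst \<phi> = rep (supp (fst \<phi>))" by (rule fst_R(1)[OF R(1)])
      also have "\<dots> = rep (supp (fst \<psi>))" by (simp only: sim_chars_supp[OF sim])
      also have "\<dots> = fst \<psi>" by (rule fst_R(1)[OF R(2), symmetric])
      finally show "\<phi> = \<psi>" using sim sim_chars_same_fst by blast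
    qed
    show "(\<lambda>\<phi>. sim_chars `` {\<phi>}) ` ?R = chars_T"
    proof (intro equalityI subsetI)
      fix \<Phi> assume "\<Phi> \<in> (\<lambda>\<phi>. sim_chars `` {\<phi>}) ` ?R"
      then show "\<Phi> \<in> chars_T" unfolding chars_T_def by (auto intro: quotientI)
    next
      fix \<Phi> :: "'s chr set" assume "\<Phi> \<in> chars_T"
      then obtain \<phi> where \<phi>: "\<phi> \<in> chars" and \<Phi>: "\<Phi> = sim_chars `` {\<phi>}"
        unfolding chars_T_def by (rule quotientE)
      have X: "supp (fst \<phi>) \<in> idems_T" using \<phi> by (simp add: supp_in_idems_T chars_idems)
      obtain \<psi> where \<psi>: "(\<phi>, \<psi>) \<in> sim_chars" "fst \<psi> = rep (supp (fst \<phi>))"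
        using sim_chars_exists[OF \<phi>] rep[OF X] by blast
      then have "\<Phi> = sim_chars `` {\<psi>}"
        unfolding \<Phi> using equiv_class_eq[OF equiv_sim_chars] by blast
      then show "\<Phi> \<in> (\<lambda>\<phi>. sim_chars `` {\<phi>}) ` ?R"
        using \<psi> X sim_chars_chars by blast
    qed
  qed
  then have "(\<Sum>\<Phi>\<in>chars_T. e_class u \<Phi>) = (\<Sum>\<phi>\<in>?R. e_class u (sim_chars `` {\<phi>}))"
    by (rule sum.reindex_bij_betw[symmetric])
  also have "\<dots> = (\<Sum>X\<in>idems_T. \<Sum>\<phi>\<in>?F X. e_class u (sim_chars `` {\<phi>}))"
  proof (rule sum.UNION_disjoint)
    show "\<forall>X\<in>idems_T. \<forall>Y\<in>idems_T. X \<noteq> Y \<longrightarrow> ?F X \<inter> ?F Y = {}"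
    proof (intro ballI impI)
      fix X Y :: "'s set" assume "X \<in> idems_T" "Y \<in> idems_T" "X \<noteq> Y"
      then have "rep X \<noteq> rep Y" using rep by metis
      then show "?F X \<inter> ?F Y = {}" by auto
    qed
  qed (simp_all add: finite_chars)
  also have "\<dots> = (\<Sum>X\<in>idems_T. e X)"
  proof (intro sum.cong refl)
    fix X :: "'s set" assume X: "X \<in> idems_T"
    have "(\<Sum>\<phi>\<in>?F X. e_class u (sim_chars `` {\<phi>})) = (\<Sum>\<phi>\<in>?F X. u X * (E_chr \<phi> * e X))"
      using rep[OF X] by (intro sum.cong refl) (simp add: e_class_eq)
    also have "\<dots> = u X * ((\<Sum>\<phi>\<in>?F X. E_chr \<phi>) * e X)"
      by (simp add: sum_distrib_left sum_distrib_right)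
    also have "(\<Sum>\<phi>\<in>?F X. E_chr \<phi>) = H (rep X)"
      using sum_E_chr[OF abelian] rep[OF X] by simp
    also have "u X * (H (rep X) * e X) = u X * H (rep X) * e X" by (simp add: mult.assoc)
    also have "u X * H (rep X) = u X" using u_mult_H[of "rep X"] rep[OF X] by simp
    finally show "(\<Sum>\<phi>\<in>?F X. e_class u (sim_chars `` {\<phi>})) = e X"
      by (simp add: u_mult_e[OF X])
  qed
  finally show ?thesis .
qed

lemma mult_sum_e_class:
  assumes abelian: "\<And>x::'s. x \<in> idems \<Longrightarrow> comm_group (maxgroup x)"
  shows "a * (\<Sum>\<Phi>\<in>chars_T. e_class u \<Phi>) = a"
proof -
  have "(\<Sum>\<Phi>\<in>chars_T. e_class u \<Phi>) = (\<Sum>X\<in>idems_T. e X)"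
    by (rule sum_e_class) (rule abelian)
  then show ?thesis by (simp only:) (rule mult_eq_left_supported, rule H_mult_sum_all_e)
qed

end

section \<open>Idempotents annihilated by all characters\<close>

text \<open>The common kernel of the functionals \<open>chi \<phi>\<close> is nilpotent. For an idempotent \<open>f\<close> it suffices to
  look at the minimal supports occurring in \<open>f\<close>: there \<open>f * f\<close> only depends on the image of \<open>f\<close> in
  the group algebra, where the characters separate points.\<close>

lemma idempotent_eq_0:
  fixes f :: "'s::lrbg semigroup_algebra"
  assumes abelian: "\<And>x::'s. x \<in> idems \<Longrightarrow> comm_group (maxgroup x)"
    and idem: "f * f = f" and chi: "\<And>\<phi>. \<phi> \<in> chars \<Longrightarrow> chi \<phi> f = 0"
  shows "f = 0"
proof (rule ccontr)
  assume "f \<noteq> 0"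
  then have "\<exists>s. coeff f s \<noteq> 0" by (metis coeff_zero semigroup_algebra_eqI)
  \<comment> \<open>The set of elements absorbed by an idempotent grows with its support, so the
    least cardinality singles out a minimal support among those occurring in
    \<open>f\<close>.\<close>
  then obtain s where s: "coeff f s \<noteq> 0"
    and min: "\<And>t. coeff f t \<noteq> 0 \<Longrightarrow>
      card {z. omega s * z = omega s} \<le> card {z. omega t * z = omega t}"
    using ex_has_least_nat[of "\<lambda>s. coeff f s \<noteq> 0" _ "\<lambda>s. card {z. omega s * z = omega s}"] by blast
  define x where "x = omega s"
  have x: "x \<in> idems" by (simp add: x_def)
  have xx: "x * x = x" using x by (rule idems_mult_self)
  have minimal: "omega t * x = omega t" if t: "coeff f t \<noteq> 0" "x * omega t = x" for t
  proof -
    have "x * z = x" if "omega t * z = omega t" for z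
      using t(2) that mult.assoc[of x "omega t" z] by simp
    then have "{z. omega t * z = omega t} \<subseteq> {z. x * z = x}" by blast
    moreover have "card {z. x * z = x} \<le> card {z. omega t * z = omega t}"
      using min[OF t(1)] by (simp add: x_def)
    \<comment> \<open>Nested sets whose cardinalities compare the other way are equal; as
      \<open>x\<close> absorbs itself, so does \<open>omega t\<close> absorb it.\<close>
    ultimately have "{z. omega t * z = omega t} = {z. x * z = x}"
      by (intro card_seteq) auto
    then show ?thesis using xx by blast
  qed
  interpret comm_group "maxgroup x" by (rule abelian[OF x])
  \<comment> \<open>The image of \<open>f\<close> in the group algebra at \<open>x\<close>: elements
    not below \<open>x\<close> are dropped, the others are multiplied into the group.\<close>
  define F where "F g = (\<Sum>t | x * omega t = x \<and> x * t = g. coeff f t)" for g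
  have F: "F g = 0" if g: "omega g = x" for g
  proof (rule characters_separate[OF finite_maxgroup])
    fix c assume c: "c \<in> hom (maxgroup x) cunits \<inter> extensional (carrier (maxgroup x))"
    then have \<phi>: "(x, c) \<in> chars" using x by (simp add: chars_iff)
    have "0 = (\<Sum>t\<in>UNIV. coeff f t * chi_basis (x, c) t)" using chi[OF \<phi>] by (simp add: chi_def)
    also have "\<dots> = (\<Sum>t | x * omega t = x. coeff f t * c (x * t))"
      by (intro sum.mono_neutral_cong_right) (auto simp: chi_basis_def)
    also have "\<dots> = (\<Sum>g\<in>carrier (maxgroup x).
        \<Sum>t | t \<in> {t. x * omega t = x} \<and> x * t = g. coeff f t * c (x * t))"
      by (rule sum.group[symmetric]) (auto simp: omega_idem_mult[OF x])
    also have "\<dots> = (\<Sum>g\<in>carrier (maxgroup x). F g * c g)"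
      unfolding F_def sum_distrib_right by (intro sum.cong refl) auto
    finally show "(\<Sum>g\<in>carrier (maxgroup x). F g * c g) = 0" by simp
  qed (use g in simp)
  have below: "x * omega p = x" "x * omega q = x" if "p * q = s" for p q
    using absorb_omega_mult[OF x, of p q] that xx by (simp_all add: x_def[symmetric])
  have "(\<Sum>q\<in>UNIV. if p * q = s then coeff f p * coeff f q else 0) = 0" for p
  proof (cases "coeff f p \<noteq> 0 \<and> x * omega p = x")
    case True
    \<comment> \<open>By minimality \<open>p\<close> has the support of \<open>x\<close>, so
      \<open>p * q\<close> depends on \<open>q\<close> only through \<open>x * q\<close>; the sum
      over \<open>q\<close> can be collected into values of \<open>F\<close>.\<close>
    then have "p * x = p" using minimal[of p] mult_omega[of p] by (metis mult.assoc)
    then have px: "p * (x * q) = p * q" for q by (simp add: mult.assoc[symmetric])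
    have "(\<Sum>q\<in>UNIV. if p * q = s then coeff f p * coeff f q else 0)
        = (\<Sum>q | x * omega q = x. if p * (x * q) = s then coeff f p * coeff f q else 0)"
      using below(2)[of p] by (intro sum.mono_neutral_cong_right) (auto simp: px)
    also have "\<dots> = (\<Sum>g\<in>carrier (maxgroup x). \<Sum>q | q \<in> {q. x * omega q = x} \<and> x * q = g.
        if p * (x * q) = s then coeff f p * coeff f q else 0)"
      by (rule sum.group[symmetric]) (auto simp: omega_idem_mult[OF x])
    also have "\<dots> = (\<Sum>g\<in>carrier (maxgroup x). if p * g = s then coeff f p * F g else 0)"
      unfolding F_def sum_distrib_left by (intro sum.cong refl) auto
    also have "\<dots> = 0" by (intro sum.neutral) (simp add: F)
    finally show ?thesis .
  next
    case False
    have "coeff f p = 0" if "p * q = s" for q using False below(1)[OF that] by blast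
    then show ?thesis by (intro sum.neutral) auto
  qed
  then have "coeff (f * f) s = 0" by (simp add: coeff_mult)
  then show False using s idem by simp
qed

section \<open>Group actions by automorphisms\<close>

locale lrbg_action = group_action W UNIV act
  for W :: "('w, 'm) monoid_scheme" and act :: "'w \<Rightarrow> 's::lrbg \<Rightarrow> 's" +
  assumes act_mult: "\<And>w s t. w \<in> carrier W \<Longrightarrow> act w (s * t) = act w s * act w t"
begin

lemma group_W: "group W"
  using group_hom group_hom.axioms(1) by blast

lemma inv_closed_W [simp]: "w \<in> carrier W \<Longrightarrow> inv\<^bsub>W\<^esub> w \<in> carrier W"
  using group_W by (rule group.inv_closed)

lemma act_one: "act \<one>\<^bsub>W\<^esub> s = s"
  using id_eq_one by (metis UNIV_I restrict_apply')

lemma act_act: "v \<in> carrier W \<Longrightarrow> w \<in> carrier W \<Longrightarrow> act v (act w s) = act (v \<otimes>\<^bsub>W\<^esub> w) s"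
  by (simp add: composition_rule)

lemma act_inv [simp]: "w \<in> carrier W \<Longrightarrow> act (inv\<^bsub>W\<^esub> w) (act w s) = s"
  by (rule orbit_sym_aux) simp_all

lemma act_inv' [simp]: "w \<in> carrier W \<Longrightarrow> act w (act (inv\<^bsub>W\<^esub> w) s) = s"
  using act_inv[of "inv\<^bsub>W\<^esub> w" s] group.inv_inv[OF group_W] by simp

lemma act_inject [simp]: "w \<in> carrier W \<Longrightarrow> act w s = act w t \<longleftrightarrow> s = t"
  by (metis act_inv)

lemma act_spow: "w \<in> carrier W \<Longrightarrow> act w (spow s n) = spow (act w s) n"
  by (induction n) (simp_all add: act_mult)

lemma omega_act: "w \<in> carrier W \<Longrightarrow> omega (act w s) = act w (omega s)"
proof -
  assume w: "w \<in> carrier W"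
  obtain n where "omega s = spow s n" by (rule omega_spow)
  then have "act w (omega s) = spow (act w s) n" using act_spow[OF w] by simp
  moreover have "act w (omega s) * act w (omega s) = act w (omega s)"
    by (simp add: act_mult[OF w, symmetric])
  ultimately show ?thesis by (metis omega_eqI)
qed

lemma act_idems: "w \<in> carrier W \<Longrightarrow> x \<in> idems \<Longrightarrow> act w x \<in> idems"
  by (simp add: idems_def act_mult[symmetric])

lemma act_simS: "w \<in> carrier W \<Longrightarrow> (act w s, act w t) \<in> simS \<longleftrightarrow> (s, t) \<in> simS"
  by (simp add: simS_iff omega_act act_mult[symmetric])

lemma act_supp:
  assumes w: "w \<in> carrier W"
  shows "act w ` supp s = supp (act w s)"
proof (intro equalityI subsetI)
  fix t assume "t \<in> act w ` supp s"
  then show "t \<in> supp (act w s)" using act_simS[OF w] by (auto simp: supp_def)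
next
  fix t assume "t \<in> supp (act w s)"
  then have "(act w s, act w (act (inv\<^bsub>W\<^esub> w) t)) \<in> simS" using w by (simp add: supp_def)
  then have "act (inv\<^bsub>W\<^esub> w) t \<in> supp s" using act_simS[OF w] by (simp add: supp_def)
  then show "t \<in> act w ` supp s" using w by (metis act_inv' imageI)
qed

lemma act_less_T:
  assumes w: "w \<in> carrier W" and XY: "less_T X Y"
  shows "less_T (act w ` X) (act w ` Y)"
proof -
  obtain x y where x: "x \<in> idems" "X = supp x" and y: "y \<in> idems" "Y = supp y"
    using less_T_idems_T[OF XY] idems_T_cases by metis
  have "inj (act w)" using w by (simp add: inj_def)
  then have "act w ` X \<noteq> act w ` Y" using XY by (simp add: inj_image_eq_iff less_T_def)
  moreover have "y * x = y" using XY x y by (simp add: less_T_def less_eq_T_supp)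
  ultimately show ?thesis
    using w x y act_idems[OF w]
    by (simp add: less_T_def act_supp less_eq_T_supp act_mult[symmetric])
qed

text \<open>Reindexes the sum in the recursion of \<open>e_circ\<close> along the action.\<close>

lemma bij_betw_less_T:
  assumes w: "w \<in> carrier W"
  shows "bij_betw (\<lambda>Y. act w ` Y) {Y. less_T X Y} {Y. less_T (act w ` X) Y}"
proof (rule bij_betw_byWitness[where f' = "\<lambda>Y. act (inv\<^bsub>W\<^esub> w) ` Y"])
  have cancel: "act (inv\<^bsub>W\<^esub> w) ` act w ` Y = Y" "act w ` act (inv\<^bsub>W\<^esub> w) ` Y = Y" for Y
    using w by (simp_all add: image_image)
  show "\<forall>Y\<in>{Y. less_T X Y}. act (inv\<^bsub>W\<^esub> w) ` act w ` Y = Y"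
    and "\<forall>Y\<in>{Y. less_T (act w ` X) Y}. act w ` act (inv\<^bsub>W\<^esub> w) ` Y = Y"
    by (simp_all add: cancel)
  show "(\<lambda>Y. act w ` Y) ` {Y. less_T X Y} \<subseteq> {Y. less_T (act w ` X) Y}"
    using act_less_T[OF w] by blast
  show "(\<lambda>Y. act (inv\<^bsub>W\<^esub> w) ` Y) ` {Y. less_T (act w ` X) Y} \<subseteq> {Y. less_T X Y}"
  proof (intro image_subsetI CollectI)
    fix Y assume "Y \<in> {Y. less_T (act w ` X) Y}"
    then have "less_T (act (inv\<^bsub>W\<^esub> w) ` act w ` X) (act (inv\<^bsub>W\<^esub> w) ` Y)"
      using w by (intro act_less_T) simp_all
    then show "less_T X (act (inv\<^bsub>W\<^esub> w) ` Y)" by (simp only: cancel(1))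
  qed
qed

section \<open>The induced action on characters\<close>

abbreviation act_character :: "'w \<Rightarrow> 's chr \<Rightarrow> 's chr" where
  "act_character \<equiv> act_chr W act"

text \<open>Removes the inverse from the definition: every element of the group at
  \<open>act w (fst \<phi>)\<close> is an image, so values are compared on images.\<close>

lemma snd_act_chr:
  assumes "w \<in> carrier W" "omega s = fst \<phi>"
  shows "snd (act_character w \<phi>) (act w s) = snd \<phi> s"
  using assms by (simp add: act_chr_def omega_act)

lemma fst_act_chr [simp]: "fst (act_character w \<phi>) = act w (fst \<phi>)"
  by (simp add: act_chr_def)

lemma act_maxgroup_cases:
  assumes "w \<in> carrier W" "omega t = act w x"
  obtains s where "omega s = x" "t = act w s"
proof
  show "omega (act (inv\<^bsub>W\<^esub> w) t) = x" using assms by (simp add: omega_act)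
  show "t = act w (act (inv\<^bsub>W\<^esub> w) t)" using assms by simp
qed

lemma act_chr_chars:
  assumes w: "w \<in> carrier W" and \<phi>: "\<phi> \<in> chars"
  shows "act_character w \<phi> \<in> chars"
proof -
  let ?g = "snd (act_character w \<phi>)"
  have "?g \<in> hom (maxgroup (act w (fst \<phi>))) cunits"
  proof (rule homI)
    fix s assume "s \<in> carrier (maxgroup (act w (fst \<phi>)))"
    then obtain s' where s': "omega s' = fst \<phi>" "s = act w s'"
      using act_maxgroup_cases[OF w] by auto
    then show "?g s \<in> carrier cunits"
      using hom_in_carrier[OF chars_hom[OF \<phi>], of s'] snd_act_chr[OF w] by simp
  next
    fix s t assume st: "s \<in> carrier (maxgroup (act w (fst \<phi>)))" "t \<in> carrier (maxgroup (act w (fst \<phi>)))"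
    obtain s' where s': "omega s' = fst \<phi>" "s = act w s'"
      using act_maxgroup_cases[OF w] st by auto
    obtain t' where t': "omega t' = fst \<phi>" "t = act w t'"
      using act_maxgroup_cases[OF w] st by auto
    have "?g (act w (s' * t')) = ?g (act w s') * ?g (act w t')"
      using s' t' snd_act_chr[OF w] chars_mult[OF \<phi> s'(1) t'(1)] by (simp add: omega_mult_same)
    then show "?g (s \<otimes>\<^bsub>maxgroup (act w (fst \<phi>))\<^esub> t) = ?g s \<otimes>\<^bsub>cunits\<^esub> ?g t"
      using s' t' by (simp add: act_mult[OF w] cunits_def)
  qed
  moreover have "?g \<in> extensional (carrier (maxgroup (act w (fst \<phi>))))"
    by (simp add: act_chr_def)
  ultimately have "(act w (fst \<phi>), ?g) \<in> chars"
    using act_idems[OF w chars_idems[OF \<phi>]] by (simp add: chars_iff)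
  then show ?thesis by (simp add: act_chr_def)
qed

lemma chars_eqI:
  assumes "\<phi> \<in> chars" "\<psi> \<in> chars" "fst \<phi> = fst \<psi>" "\<And>s. omega s = fst \<phi> \<Longrightarrow> snd \<phi> s = snd \<psi> s"
  shows "\<phi> = (\<psi> :: 's chr)"
  using assms by (auto simp: chars_def intro: extensionalityI)

lemma act_chr_one: "\<phi> \<in> chars \<Longrightarrow> act_character \<one>\<^bsub>W\<^esub> \<phi> = \<phi>"
proof (rule chars_eqI)
  assume \<phi>: "\<phi> \<in> chars"
  have one: "\<one>\<^bsub>W\<^esub> \<in> carrier W" using group_W by (simp add: group.is_monoid monoid.one_closed)
  show "act_character \<one>\<^bsub>W\<^esub> \<phi> \<in> chars" using act_chr_chars[OF one \<phi>] .
  fix s assume "omega s = fst (act_character \<one>\<^bsub>W\<^esub> \<phi>)"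
  then show "snd (act_character \<one>\<^bsub>W\<^esub> \<phi>) s = snd \<phi> s"
    using snd_act_chr[OF one, of s \<phi>] by (simp add: act_one)
qed (simp_all add: act_one)

lemma act_chr_act_chr:
  assumes v: "v \<in> carrier W" and w: "w \<in> carrier W" and \<phi>: "\<phi> \<in> chars"
  shows "act_character v (act_character w \<phi>) = act_character (v \<otimes>\<^bsub>W\<^esub> w) \<phi>"
proof (rule chars_eqI)
  have vw: "v \<otimes>\<^bsub>W\<^esub> w \<in> carrier W" using v w group_W by (simp add: group.is_monoid monoid.m_closed)
  show "act_character v (act_character w \<phi>) \<in> chars" "act_character (v \<otimes>\<^bsub>W\<^esub> w) \<phi> \<in> chars"
    using act_chr_chars v w vw \<phi> by blast+
  fix t assume "omega t = fst (act_character v (act_character w \<phi>))"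
  then obtain s where s: "omega s = fst \<phi>" "t = act (v \<otimes>\<^bsub>W\<^esub> w) s"
    using act_maxgroup_cases[OF vw] by (auto simp: act_act v w)
  have "snd (act_character v (act_character w \<phi>)) (act v (act w s)) = snd \<phi> s"
    using s by (simp add: snd_act_chr v w omega_act)
  then show "snd (act_character v (act_character w \<phi>)) t = snd (act_character (v \<otimes>\<^bsub>W\<^esub> w) \<phi>) t"
    using s by (simp add: act_act v w snd_act_chr vw)
qed (simp add: act_act v w)

lemma act_chr_sim:
  assumes w: "w \<in> carrier W" and sim: "(\<phi>, \<psi>) \<in> sim_chars"
  shows "(act_character w \<phi>, act_character w \<psi>) \<in> sim_chars"
proof -
  have \<phi>: "\<phi> \<in> chars" and \<psi>: "\<psi> \<in> chars" using sim_chars_chars[OF sim] .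
  have "snd (act_character w \<phi>) t = snd (act_character w \<psi>) (act w (fst \<psi>) * t)"
    if t: "omega t = act w (fst \<phi>)" for t
  proof -
    obtain s where s: "omega s = fst \<phi>" "t = act w s" using act_maxgroup_cases[OF w t] .
    have "omega (fst \<psi> * s) = fst \<psi>"
      using s sim_chars_absorb[OF sim] by (simp add: omega_idem_mult chars_idems \<psi>)
    then show ?thesis
      using s sim by (simp add: act_mult[OF w, symmetric] snd_act_chr[OF w] sim_chars_iff)
  qed
  then show ?thesis
    using sim_chars_supp[OF sim] act_chr_chars[OF w] \<phi> \<psi>
    by (simp add: sim_chars_iff act_supp[OF w, symmetric])
qed

lemma act_chr_class:
  assumes w: "w \<in> carrier W" and \<phi>: "\<phi> \<in> chars"
  shows "act_character w ` (sim_chars `` {\<phi>}) = sim_chars `` {act_character w \<phi>}"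
proof (intro equalityI subsetI)
  fix \<psi> assume "\<psi> \<in> act_character w ` (sim_chars `` {\<phi>})"
  then show "\<psi> \<in> sim_chars `` {act_character w \<phi>}" using act_chr_sim[OF w] by auto
next
  fix \<psi> assume "\<psi> \<in> sim_chars `` {act_character w \<phi>}"
  then have sim: "(act_character w \<phi>, \<psi>) \<in> sim_chars" by simp
  have w': "inv\<^bsub>W\<^esub> w \<in> carrier W" using w by simp
  have \<psi>: "\<psi> \<in> chars" using sim_chars_chars[OF sim] by blast
  have cancel: "act_character (inv\<^bsub>W\<^esub> w) (act_character w \<phi>) = \<phi>"
    "act_character w (act_character (inv\<^bsub>W\<^esub> w) \<psi>) = \<psi>"
    using act_chr_act_chr \<phi> \<psi> w w' act_chr_one group.l_inv[OF group_W w] group.r_inv[OF group_W w]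
    by simp_all
  have "(\<phi>, act_character (inv\<^bsub>W\<^esub> w) \<psi>) \<in> sim_chars"
    using act_chr_sim[OF w' sim] cancel(1) by simp
  then show "\<psi> \<in> act_character w ` (sim_chars `` {\<phi>})"
    using cancel(2) by (metis Image_singleton_iff imageI)
qed

text \<open>Moving character and argument together changes nothing, already on basis
  elements.\<close>

lemma chi_act:
  assumes w: "w \<in> carrier W" and \<phi>: "\<phi> \<in> chars"
  shows "chi (act_character w \<phi>) (lin_ext (act w) a) = chi \<phi> a"
proof -
  have "chi_basis (act_character w \<phi>) (act w s) = chi_basis \<phi> s" for s
    using snd_act_chr[OF w, of "fst \<phi> * s" \<phi>] w
    by (simp add: chi_basis_def omega_act act_mult[symmetric] omega_idem_mult[OF chars_idems[OF \<phi>]])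
  then show ?thesis
    by (simp add: lin_ext_def chi_sum chi_scale chi_H) (simp add: chi_def)
qed

lemma act_E_chr:
  assumes w: "w \<in> carrier W" and \<phi>: "\<phi> \<in> chars"
  shows "lin_ext (act w) (E_chr \<phi>) = E_chr (act_character w \<phi>)"
proof -
  let ?x = "fst \<phi>"
  have bij: "bij_betw (act w) (carrier (maxgroup ?x)) (carrier (maxgroup (act w ?x)))"
    by (rule bij_betw_byWitness[where f' = "act (inv\<^bsub>W\<^esub> w)"]) (auto simp: w omega_act)
  have "lin_ext (act w) (E_chr \<phi>) = scale (1 / of_nat (card (carrier (maxgroup ?x))))
      (\<Sum>s\<in>carrier (maxgroup ?x). scale (cnj (snd \<phi> s)) (H (act w s)))"
    by (simp add: E_chr_def lin_ext_scale lin_ext_sum lin_ext_H)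
  also have "(\<Sum>s\<in>carrier (maxgroup ?x). scale (cnj (snd \<phi> s)) (H (act w s)))
      = (\<Sum>s\<in>carrier (maxgroup ?x). scale (cnj (snd (act_character w \<phi>) (act w s))) (H (act w s)))"
    by (intro sum.cong refl) (simp add: snd_act_chr[OF w])
  also have "\<dots> = (\<Sum>t\<in>carrier (maxgroup (act w ?x)). scale (cnj (snd (act_character w \<phi>) t)) (H t))"
    by (rule sum.reindex_bij_betw[OF bij])
  finally show ?thesis by (simp add: E_chr_def bij_betw_same_card[OF bij])
qed

section \<open>Orbits of character classes\<close>

abbreviation act_class :: "'w \<Rightarrow> 's chr set \<Rightarrow> 's chr set" where
  "act_class w \<Phi> \<equiv> act_character w ` \<Phi>"

lemma chars_T_cases:
  assumes "\<Phi> \<in> chars_T"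
  obtains \<phi> where "\<phi> \<in> chars" "\<Phi> = sim_chars `` {\<phi>}"
  using assms unfolding chars_T_def by (rule quotientE)

lemma class_in_chars_T: "\<phi> \<in> chars \<Longrightarrow> sim_chars `` {\<phi>} \<in> chars_T"
  unfolding chars_T_def by (rule quotientI)

lemma act_class_chars_T: "w \<in> carrier W \<Longrightarrow> \<Phi> \<in> chars_T \<Longrightarrow> act_class w \<Phi> \<in> chars_T"
  by (metis act_chr_class act_chr_chars chars_T_cases class_in_chars_T)

lemma act_class_one: "\<Phi> \<in> chars_T \<Longrightarrow> act_class \<one>\<^bsub>W\<^esub> \<Phi> = \<Phi>"
proof -
  assume "\<Phi> \<in> chars_T"
  then obtain \<phi> where \<phi>: "\<phi> \<in> chars" "\<Phi> = sim_chars `` {\<phi>}" by (rule chars_T_cases)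
  have "\<one>\<^bsub>W\<^esub> \<in> carrier W" using group_W by (simp add: group.is_monoid monoid.one_closed)
  then show ?thesis using \<phi> by (simp add: act_chr_class act_chr_one)
qed

lemma act_class_act_class:
  assumes "v \<in> carrier W" "w \<in> carrier W" "\<Phi> \<in> chars_T"
  shows "act_class v (act_class w \<Phi>) = act_class (v \<otimes>\<^bsub>W\<^esub> w) \<Phi>"
proof -
  obtain \<phi> where \<phi>: "\<phi> \<in> chars" "\<Phi> = sim_chars `` {\<phi>}" using assms(3) by (rule chars_T_cases)
  have "v \<otimes>\<^bsub>W\<^esub> w \<in> carrier W" using assms group_W by (simp add: group.is_monoid monoid.m_closed)
  then show ?thesis using assms \<phi> by (simp add: act_chr_class act_chr_act_chr act_chr_chars)
qed

lemma act_class_inv: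
  assumes "w \<in> carrier W" "\<Phi> \<in> chars_T"
  shows "act_class (inv\<^bsub>W\<^esub> w) (act_class w \<Phi>) = \<Phi>" "act_class w (act_class (inv\<^bsub>W\<^esub> w) \<Phi>) = \<Phi>"
  by (simp_all only: act_class_act_class assms inv_closed_W group.l_inv[OF group_W]
      group.r_inv[OF group_W] act_class_one)

abbreviation class_orbits :: "'s chr set set set" where
  "class_orbits \<equiv> chars_T_orbits W act"

lemma class_orbits_eq: "class_orbits = (\<lambda>\<Phi>. (\<lambda>w. act_class w \<Phi>) ` carrier W) ` chars_T"
  by (auto simp: chars_T_orbits_def orbits_def orbit_def)

lemma class_orbit_subset: "\<Lambda> \<in> class_orbits \<Longrightarrow> \<Lambda> \<subseteq> chars_T"
  unfolding class_orbits_eq using act_class_chars_T by blast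

lemma class_orbit_nonempty: "\<Lambda> \<in> class_orbits \<Longrightarrow> \<Lambda> \<noteq> {}"
  unfolding class_orbits_eq using group.is_monoid[OF group_W] monoid.one_closed by blast

lemma class_in_orbit: "\<Phi> \<in> chars_T \<Longrightarrow> \<exists>\<Lambda>\<in>class_orbits. \<Phi> \<in> \<Lambda>"
proof -
  assume \<Phi>: "\<Phi> \<in> chars_T"
  have "\<one>\<^bsub>W\<^esub> \<in> carrier W" using group_W by (simp add: group.is_monoid monoid.one_closed)
  then have "\<Phi> \<in> (\<lambda>w. act_class w \<Phi>) ` carrier W" using act_class_one[OF \<Phi>] by (metis imageI)
  then show ?thesis unfolding class_orbits_eq using \<Phi> by blast
qed

lemma class_orbit_act:
  assumes \<Lambda>: "\<Lambda> \<in> class_orbits" and "\<Phi> \<in> \<Lambda>" "w \<in> carrier W"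
  shows "act_class w \<Phi> \<in> \<Lambda>"
proof -
  obtain \<Psi> where \<Psi>: "\<Psi> \<in> chars_T" "\<Lambda> = (\<lambda>w. act_class w \<Psi>) ` carrier W"
    using \<Lambda> unfolding class_orbits_eq by blast
  then obtain v where v: "v \<in> carrier W" "\<Phi> = act_class v \<Psi>" using assms by blast
  have "w \<otimes>\<^bsub>W\<^esub> v \<in> carrier W" using assms v group_W by (simp add: group.is_monoid monoid.m_closed)
  then show ?thesis using \<Psi> v assms by (simp only: act_class_act_class) blast
qed

lemma class_orbit_transitive:
  assumes \<Lambda>: "\<Lambda> \<in> class_orbits" and "\<Phi> \<in> \<Lambda>" "\<Psi> \<in> \<Lambda>"
  shows "\<exists>w\<in>carrier W. \<Psi> = act_class w \<Phi>"
proof -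
  obtain \<Theta> where \<Theta>: "\<Theta> \<in> chars_T" "\<Lambda> = (\<lambda>w. act_class w \<Theta>) ` carrier W"
    using \<Lambda> unfolding class_orbits_eq by blast
  then obtain v w where v: "v \<in> carrier W" "\<Phi> = act_class v \<Theta>"
    and w: "w \<in> carrier W" "\<Psi> = act_class w \<Theta>" using assms by blast
  have "\<Theta> = act_class (inv\<^bsub>W\<^esub> v) \<Phi>"
    unfolding v(2) by (rule act_class_inv(1)[OF v(1) \<Theta>(1), symmetric])
  then have "\<Psi> = act_class w (act_class (inv\<^bsub>W\<^esub> v) \<Phi>)" using w(2) by (rule subst)
  moreover have "\<Phi> \<in> chars_T" using class_orbit_subset[OF \<Lambda>] assms by blast
  ultimately have "\<Psi> = act_class (w \<otimes>\<^bsub>W\<^esub> inv\<^bsub>W\<^esub> v) \<Phi>"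
    by (simp only: act_class_act_class[OF w(1) inv_closed_W[OF v(1)]])
  moreover have "w \<otimes>\<^bsub>W\<^esub> inv\<^bsub>W\<^esub> v \<in> carrier W"
    using v w group_W by (simp add: group.is_monoid monoid.m_closed)
  ultimately show ?thesis by blast
qed

lemma class_orbits_disjoint:
  assumes "\<Lambda> \<in> class_orbits" "M \<in> class_orbits" "\<Phi> \<in> \<Lambda>" "\<Phi> \<in> M"
  shows "\<Lambda> = M"
  using assms class_orbit_transitive class_orbit_act by blast

lemma class_orbit_bij:
  assumes \<Lambda>: "\<Lambda> \<in> class_orbits" and w: "w \<in> carrier W"
  shows "bij_betw (act_class w) \<Lambda> \<Lambda>"
proof (rule bij_betw_byWitness[where f' = "act_class (inv\<^bsub>W\<^esub> w)"])
  show "\<forall>\<Phi>\<in>\<Lambda>. act_class (inv\<^bsub>W\<^esub> w) (act_class w \<Phi>) = \<Phi>"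
    by (intro ballI act_class_inv(1)[OF w] subsetD[OF class_orbit_subset[OF \<Lambda>]])
  show "\<forall>\<Phi>\<in>\<Lambda>. act_class w (act_class (inv\<^bsub>W\<^esub> w) \<Phi>) = \<Phi>"
    by (intro ballI act_class_inv(2)[OF w] subsetD[OF class_orbit_subset[OF \<Lambda>]])
  show "act_class w ` \<Lambda> \<subseteq> \<Lambda>"
    by (intro image_subsetI class_orbit_act[OF \<Lambda> _ w])
  show "act_class (inv\<^bsub>W\<^esub> w) ` \<Lambda> \<subseteq> \<Lambda>"
    by (intro image_subsetI class_orbit_act[OF \<Lambda> _ inv_closed_W[OF w]])
qed

lemma finite_chars_T: "finite (chars_T :: 's chr set set)"
  unfolding chars_T_def by (rule finite_quotient[OF finite_chars]) (auto simp: sim_chars_def)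

lemma finite_class_orbit: "\<Lambda> \<in> class_orbits \<Longrightarrow> finite \<Lambda>"
  using class_orbit_subset finite_chars_T finite_subset by blast

lemma finite_class_orbits: "finite class_orbits"
  unfolding class_orbits_eq using finite_chars_T by simp

lemma sum_class_orbits: "(\<Sum>\<Lambda>\<in>class_orbits. e_orbit u \<Lambda>) = (\<Sum>\<Phi>\<in>chars_T. e_class u \<Phi>)"
proof -
  have "chars_T = \<Union>class_orbits" using class_orbit_subset class_in_orbit by blast
  moreover have "(\<Sum>\<Phi>\<in>\<Union>class_orbits. e_class u \<Phi>) = (\<Sum>\<Lambda>\<in>class_orbits. \<Sum>\<Phi>\<in>\<Lambda>. e_class u \<Phi>)"
  proof (subst sum.Union_disjoint)
    show "\<forall>\<Lambda>\<in>class_orbits. finite \<Lambda>" using finite_class_orbit by blast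
    show "\<forall>\<Lambda>\<in>class_orbits. \<forall>M\<in>class_orbits. \<Lambda> \<noteq> M \<longrightarrow> \<Lambda> \<inter> M = {}"
      using class_orbits_disjoint by blast
  qed simp
  ultimately show ?thesis by (simp add: e_orbit_def)
qed

end

section \<open>Invariant sections\<close>

locale equivariant_section = homogeneous u + lrbg_action W act
  for u :: "'s::lrbg set \<Rightarrow> 's semigroup_algebra"
    and W :: "('w, 'm) monoid_scheme" and act :: "'w \<Rightarrow> 's \<Rightarrow> 's" +
  assumes invariant: "invariant_section W act u"
begin

lemma act_u: "w \<in> carrier W \<Longrightarrow> X \<in> idems_T \<Longrightarrow> lin_ext (act w) (u X) = u (act w ` X)"
  using invariant by (simp add: invariant_section_def)

text \<open>The recursion is preserved because \<open>act w\<close> is multiplicative, carries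
  \<open>u X\<close> to the section at the image, and permutes the larger supports
  accordingly.\<close>

lemma act_e:
  assumes w: "w \<in> carrier W"
  shows "X \<in> idems_T \<Longrightarrow> lin_ext (act w) (e X) = e (act w ` X)"
proof (induction X rule: less_T_induct)
  case (step X)
  have IH: "lin_ext (act w) (e Z) = e (act w ` Z)" if XZ: "less_T X Z" for Z
    using step.IH[OF XZ] .
  have "lin_ext (act w) (\<Sum>Z | less_T X Z. e Z) = (\<Sum>Z | less_T X Z. e (act w ` Z))"
    unfolding lin_ext_sum by (intro sum.cong refl) (simp add: IH)
  also have "\<dots> = (\<Sum>Z | less_T (act w ` X) Z. e Z)"
    by (rule sum.reindex_bij_betw[OF bij_betw_less_T[OF w]])
  finally show ?case
    using act_u[OF w step.hyps] e_unfold[of X] e_unfold[of "act w ` X"]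
    by (simp add: lin_ext_diff lin_ext_mult act_mult[OF w])
qed

lemma act_e_class:
  assumes w: "w \<in> carrier W" and "\<Phi> \<in> chars_T"
  shows "lin_ext (act w) (e_class u \<Phi>) = e_class u (act_class w \<Phi>)"
proof -
  obtain \<phi> where \<phi>: "\<phi> \<in> chars" "\<Phi> = sim_chars `` {\<phi>}" using assms(2) by (rule chars_T_cases)
  have X: "supp (fst \<phi>) \<in> idems_T" using \<phi> by (simp add: supp_in_idems_T chars_idems)
  show ?thesis
    unfolding \<phi>(2) act_chr_class[OF w \<phi>(1)] e_class_eq[OF \<phi>(1)] e_class_eq[OF act_chr_chars[OF w \<phi>(1)]]
    by (simp add: lin_ext_mult act_mult[OF w] act_u[OF w X] act_e[OF w X] act_E_chr[OF w \<phi>(1)] act_supp[OF w])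
qed

lemma e_orbit_invariant: "\<Lambda> \<in> class_orbits \<Longrightarrow> e_orbit u \<Lambda> \<in> invariant_subalgebra W act"
proof -
  assume \<Lambda>: "\<Lambda> \<in> class_orbits"
  have "lin_ext (act w) (e_orbit u \<Lambda>) = e_orbit u \<Lambda>" if w: "w \<in> carrier W" for w
  proof -
    have "lin_ext (act w) (e_orbit u \<Lambda>) = (\<Sum>\<Phi>\<in>\<Lambda>. e_class u (act_class w \<Phi>))"
      unfolding e_orbit_def lin_ext_sum
      using act_e_class[OF w] class_orbit_subset[OF \<Lambda>] by (intro sum.cong refl) blast
    also have "\<dots> = e_orbit u \<Lambda>"
      unfolding e_orbit_def by (rule sum.reindex_bij_betw[OF class_orbit_bij[OF \<Lambda> w]])
    finally show ?thesis .
  qed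
  then show ?thesis by (simp add: invariant_subalgebra_def)
qed

lemma e_class_mult_e_class:
  assumes "\<Phi> \<in> chars_T" "\<Psi> \<in> chars_T"
  shows "e_class u \<Phi> * e_class u \<Psi> = (if \<Phi> = \<Psi> then e_class u \<Phi> else 0)"
proof -
  obtain \<phi> where \<phi>: "\<phi> \<in> chars" "\<Phi> = sim_chars `` {\<phi>}" using assms(1) by (rule chars_T_cases)
  obtain \<psi> where \<psi>: "\<psi> \<in> chars" "\<Psi> = sim_chars `` {\<psi>}" using assms(2) by (rule chars_T_cases)
  have "\<Phi> = \<Psi> \<longleftrightarrow> (\<phi>, \<psi>) \<in> sim_chars"
    using eq_equiv_class_iff[OF equiv_sim_chars \<phi>(1) \<psi>(1)] \<phi> \<psi> by simp
  then show ?thesis using e_class_mult[OF \<phi>(1) \<psi>(1)] \<phi> \<psi> by simp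
qed

lemma e_orbit_mult:
  assumes \<Lambda>: "\<Lambda> \<in> class_orbits" and M: "M \<in> class_orbits"
  shows "e_orbit u \<Lambda> * e_orbit u M = (if \<Lambda> = M then e_orbit u \<Lambda> else 0)"
proof -
  have "e_orbit u \<Lambda> * e_orbit u M = (\<Sum>\<Phi>\<in>\<Lambda>. \<Sum>\<Psi>\<in>M. if \<Phi> = \<Psi> then e_class u \<Phi> else 0)"
    unfolding e_orbit_def sum_distrib_left sum_distrib_right
    using class_orbit_subset \<Lambda> M by (subst sum.swap, intro sum.cong refl e_class_mult_e_class) blast+
  also have "\<dots> = (\<Sum>\<Phi>\<in>\<Lambda>. if \<Phi> \<in> M then e_class u \<Phi> else 0)"
    by (simp add: finite_class_orbit[OF M])
  also have "\<dots> = (\<Sum>\<Phi>\<in>\<Lambda>. if \<Lambda> = M then e_class u \<Phi> else 0)"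
    using class_orbits_disjoint[OF \<Lambda> M] by (intro sum.cong refl) auto
  finally show ?thesis by (simp add: e_orbit_def)
qed

lemma chi_e_orbit:
  assumes \<Lambda>: "\<Lambda> \<in> class_orbits" and \<psi>: "\<psi> \<in> chars"
  shows "chi \<psi> (e_orbit u \<Lambda>) = (if sim_chars `` {\<psi>} \<in> \<Lambda> then 1 else 0)"
proof -
  have "chi \<psi> (e_orbit u \<Lambda>) = (\<Sum>\<Phi>\<in>\<Lambda>. if \<Phi> = sim_chars `` {\<psi>} then 1 else 0)"
    unfolding e_orbit_def chi_sum
  proof (intro sum.cong refl)
    fix \<Phi> assume "\<Phi> \<in> \<Lambda>"
    then have "\<Phi> \<in> chars_T" using class_orbit_subset[OF \<Lambda>] by blast
    then obtain \<phi> where \<phi>: "\<phi> \<in> chars" "\<Phi> = sim_chars `` {\<phi>}" by (rule chars_T_cases)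
    then show "chi \<psi> (e_class u \<Phi>) = (if \<Phi> = sim_chars `` {\<psi>} then 1 else 0)"
      using chi_e_class[OF \<phi>(1) \<psi>] eq_equiv_class_iff[OF equiv_sim_chars \<phi>(1) \<psi>] by simp
  qed
  then show ?thesis using finite_class_orbit[OF \<Lambda>] by simp
qed

text \<open>An invariant \<open>a\<close> equals its own translate, so \<open>chi_act\<close> moves
  the functional alone, and \<open>chi\<close> depends only on the class.\<close>

lemma chi_invariant_orbit:
  assumes a: "a \<in> invariant_subalgebra W act" and \<Lambda>: "\<Lambda> \<in> class_orbits"
    and "\<phi> \<in> chars" "\<psi> \<in> chars" "sim_chars `` {\<phi>} \<in> \<Lambda>" "sim_chars `` {\<psi>} \<in> \<Lambda>"
  shows "chi \<phi> a = chi \<psi> a"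
proof -
  obtain w where w: "w \<in> carrier W" and "sim_chars `` {\<psi>} = act_class w (sim_chars `` {\<phi>})"
    using class_orbit_transitive[OF \<Lambda>] assms by blast
  then have "sim_chars `` {act_character w \<phi>} = sim_chars `` {\<psi>}"
    using act_chr_class assms by simp
  then have "(act_character w \<phi>, \<psi>) \<in> sim_chars"
    using eq_equiv_class_iff[OF equiv_sim_chars act_chr_chars[OF w] \<open>\<psi> \<in> chars\<close>] assms by simp
  from chi_sim[OF this] have "chi \<psi> a = chi (act_character w \<phi>) (lin_ext (act w) a)"
    using a w by (simp add: invariant_subalgebra_def)
  then show ?thesis using chi_act[OF w] assms by simp
qed

lemma primitive_e_orbit:
  assumes abelian: "\<And>x::'s. x \<in> idems \<Longrightarrow> comm_group (maxgroup x)" and \<Lambda>: "\<Lambda> \<in> class_orbits"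
  shows "primitive_idempotent (invariant_subalgebra W act) (e_orbit u \<Lambda>)"
  unfolding primitive_idempotent_def
proof (intro conjI ballI impI)
  let ?A = "invariant_subalgebra W act"
  show "e_orbit u \<Lambda> \<in> ?A" using e_orbit_invariant[OF \<Lambda>] .
  show "e_orbit u \<Lambda> * e_orbit u \<Lambda> = e_orbit u \<Lambda>" using e_orbit_mult[OF \<Lambda> \<Lambda>] by simp
  \<comment> \<open>Any character in the orbit serves as a test: it shows that the orbit sum is
    nonzero and decides which summand of a decomposition vanishes.\<close>
  obtain \<phi> where \<phi>: "\<phi> \<in> chars" "sim_chars `` {\<phi>} \<in> \<Lambda>"
    using class_orbit_nonempty[OF \<Lambda>] class_orbit_subset[OF \<Lambda>] chars_T_cases by (metis all_not_in_conv subsetD)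
  then show "e_orbit u \<Lambda> \<noteq> 0" using chi_e_orbit[OF \<Lambda> \<phi>(1)] by (auto simp: chi_zero)
  fix f g assume f: "f \<in> ?A" and g: "g \<in> ?A"
    and *: "f * f = f \<and> g * g = g \<and> f * g = 0 \<and> g * f = 0 \<and> e_orbit u \<Lambda> = f + g"
  have sum: "chi \<psi> f + chi \<psi> g = (if sim_chars `` {\<psi>} \<in> \<Lambda> then 1 else 0)" if "\<psi> \<in> chars" for \<psi>
    using chi_e_orbit[OF \<Lambda> that] * by (simp add: chi_add)
  have bool: "chi \<psi> h = 0 \<or> chi \<psi> h = 1" if "\<psi> \<in> chars" "h * h = h"
    for \<psi> :: "'s chr" and h
    using chi_mult[OF that(1), of h h] that(2) by simp
  \<comment> \<open>Stated for a pair \<open>h\<close>, \<open>h'\<close> so that it applies to both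
    summands. On the orbit the value of \<open>h\<close> is the one at \<open>\<phi>\<close>;
    elsewhere two values from 0 and 1 add up to 0.\<close>
  have vanish: "h = 0" if h: "h \<in> ?A" "h * h = h" and h': "h' * h' = h'"
    and hh': "\<And>\<psi>. \<psi> \<in> chars \<Longrightarrow> chi \<psi> h + chi \<psi> h' = (if sim_chars `` {\<psi>} \<in> \<Lambda> then 1 else 0)"
    and \<phi>h: "chi \<phi> h = 0" for h h'
  proof (rule idempotent_eq_0[OF abelian h(2)])
    fix \<psi> :: "'s chr" assume \<psi>: "\<psi> \<in> chars"
    show "chi \<psi> h = 0"
    proof (cases "sim_chars `` {\<psi>} \<in> \<Lambda>")
      case True
      then show ?thesis using chi_invariant_orbit[OF h(1) \<Lambda> \<phi>(1) \<psi> \<phi>(2)] \<phi>h by simp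
    next
      case False
      then show ?thesis using hh'[OF \<psi>] bool[OF \<psi> h(2)] bool[OF \<psi> h'] by auto
    qed
  qed
  have "chi \<phi> f = 0 \<or> chi \<phi> g = 0"
    using sum[OF \<phi>(1)] bool[OF \<phi>(1), of f] bool[OF \<phi>(1), of g] \<phi>(2) * by auto
  then show "f = 0 \<or> g = 0"
    using vanish[of f g] vanish[of g f] f g * sum by (metis add.commute)
qed

end

theorem theorem5p5:
  fixes W :: "('w, 'm) monoid_scheme"
    and act :: "'w \<Rightarrow> 's::lrbg \<Rightarrow> 's"
    and u :: "'s set \<Rightarrow> 's semigroup_algebra"
  assumes abelian: "\<And>x::'s. x \<in> idems \<Longrightarrow> comm_group (maxgroup x)"
    and "group W" and "finite (carrier W)"
    and "group_action W UNIV act"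
    and "\<And>w s t. w \<in> carrier W \<Longrightarrow> act w (s * t) = act w s * act w t"
    and "homogeneous_section u"
    and "invariant_section W act u"
  shows "complete_system (invariant_subalgebra W act) (chars_T_orbits W act) (e_orbit u)"
proof -
  interpret group_action W UNIV act by fact
  interpret equivariant_section u W act by unfold_locales fact+
  let ?A = "invariant_subalgebra W act" and ?r = "\<Sum>\<Lambda>\<in>class_orbits. e_orbit u \<Lambda>"
  have right: "a * ?r = a" for a
    unfolding sum_class_orbits by (rule mult_sum_e_class) (rule abelian)
  have "lin_ext (act w) ?r = ?r" if "w \<in> carrier W" for w
    unfolding lin_ext_sum using e_orbit_invariant that
    by (intro sum.cong refl) (simp add: invariant_subalgebra_def)
  then have "?r \<in> ?A" by (simp add: invariant_subalgebra_def)
  \<comment> \<open>The product \<open>i * ?r\<close> is \<open>i\<close>, since \<open>?r\<close>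
    is a right identity, and it is \<open>?r\<close>, since \<open>?r\<close> belongs to the
    subalgebra.\<close>
  then have "?r = i" if "is_identity ?A i" for i
    using that right[of i] by (simp add: is_identity_def)
  then show ?thesis
    unfolding complete_system_def
    using right primitive_e_orbit[OF abelian] e_orbit_mult finite_class_orbits by simp
qed

end
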